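(* Let $n=1$, $\tau>0$, and assume: (Slater) there are $\overline\pi\in\Pi$ and $\xi>0$ with $U^{\overline\pi}_{g}(\rho)-b\ge\xi$; (Strong duality) there is a pair $(\pi_\tau^\star,\lambda^\star)$, with $\pi_\tau^\star$ optimal for the primal problem and $\lambda^\star\in\arg\min_{\lambda\ge0}D(\lambda)$, such that $V_\tau^\star=D_\tau^\star=L(\pi_\tau^\star,\lambda^\star)$; (Exploration) there is $d>0$ with $d^\pi_\rho(s)\ge d$ for all $s\in\mathcal S$, $\pi\in\Pi$. Let $\ell_c=\sqrt{|\mathcal A|}/(1-\gamma)^2$. There exist problem-dependent constants $C_1,C_2>0$ such that for every $\varepsilon_0,\varepsilon_1>0$, the Bisection Method with NPG Subroutine (described in the context), with step-size $\eta=(1-\gamma)/\tau$ and suitably chosen threshold $\varepsilon$ and inner iteration numbers $N_1,N_2$, returns a pair $(\pi,\lambda)$ satisfying $$D(\lambda)-D_\tau^\star\le\varepsilon_0,$$ $$\|\pi-\pi_\tau^\star\|_2\le C_1\sqrt{\varepsilon_0}+\varepsilon_1,$$ $$|V_\tau^\pi(\rho)-V_\tau^\star|\le 2\varepsilon_0+\ell_cC_1C_2\sqrt{\varepsilon_0}+\Big(\ell_cC_2+\frac{3\gamma}{2\tau}\Big)\varepsilon_1,$$ $$[b-U_{g}^\pi(\rho)]_+\le \ell_c\big(C_1\sqrt{\varepsilon_0}+\varepsilon_1\big),$$ in at most $\mathcal O\big(\log^2(1/\varepsilon_0)+\log(1/\varepsilon_1)\big)$ iterations.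
   Context: Constrained MDP with one constraint: finite state space $\mathcal S$, finite action space $\mathcal A$, transition kernel $P(\cdot|s,a)\in\Delta(\mathcal S)$, reward $r:\mathcal S\times\mathcal A\to[0,1]$, utility $g:\mathcal S\times\mathcal A\to[0,1]$, threshold $b\in[0,1/(1-\gamma)]$, discount $\gamma\in[0,1)$, initial distribution $\rho\in\Delta(\mathcal S)$. A policy is a map $\pi:\mathcal S\to\Delta(\mathcal A)$, viewed as a vector in $\mathbb R^{|\mathcal S||\mathcal A|}$; trajectories satisfy $s_0\sim\rho$, $a_t\sim\pi(\cdot|s_t)$, $s_{t+1}\sim P(\cdot|s_t,a_t)$. $\Pi$ is the class of soft-max policies $\pi_\theta(a|s)=\exp(\theta(s,a))/\sum_{a'}\exp(\theta(s,a'))$, $\theta\in\mathbb R^{|\mathcal S||\mathcal A|}$. $V^\pi(\rho)=\mathbb E[\sum_{t\ge0}\gamma^t r(s_t,a_t)]$, $U^\pi_{g}(\rho)=\mathbb E[\sum_{t\ge0}\gamma^t g(s_t,a_t)]$, $\mathcal H(\rho,\pi)=\mathbb E[\sum_{t\ge0}-\gamma^t\log\pi(a_t|s_t)]$ (natural log), $V_\tau^\pi(\rho)=V^\pi(\rho)+\tau\mathcal H(\rho,\pi)$. Discounted state visitation distribution: $d^\pi_\rho(s)=(1-\gamma)\sum_{t\ge0}\gamma^t\Pr(s_t=s\mid\pi,s_0\sim\rho)$. Primal problem: $\max_{\pi\in\Pi}V_\tau^\pi(\rho)$ subject to $U^\pi_{g}(\rho)\ge b$, with an optimal policy $\pi_\tau^\star$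 and optimal value $V_\tau^\star=V_\tau^{\pi_\tau^\star}(\rho)$. Lagrangian $L(\pi,\lambda)=V_\tau^\pi(\rho)+\lambda(U^\pi_{g}(\rho)-b)$; dual function $D(\lambda)=\max_{\pi\in\Pi}L(\pi,\lambda)$, which is convex and (under the exploration assumption) differentiable; $D_\tau^\star=\min_{\lambda\ge0}D(\lambda)$. $[x]_+=\max\{x,0\}$. For $\lambda\in\mathbb R$ let $r_\lambda=r+\lambda g$, let $V_\lambda^\pi(s)$ be the entropy-regularized value function (weight $\tau$) with reward $r_\lambda$ and initial state $s$, and $Q_\lambda^\pi(s,a)=r_\lambda(s,a)+\gamma\,\mathbb E_{s'\sim P(\cdot|s,a)}[V_\lambda^\pi(s')]$. Subroutine $\mathrm{NPG}_{Sub}(\lambda,\pi^{(0)},\eta,N)$: for $t=0,\dots,N-1$ set $\pi^{(t+1)}(a|s)\propto(\pi^{(t)}(a|s))^{1-\eta\tau/(1-\gamma)}\exp\big(\eta Q_\lambda^{\pi^{(t)}}(s,a)/(1-\gamma)\big)$ (normalized over $a$); return $\pi^{(N)}$. Subroutine $\mathrm{Grad}_{Sub}(\lambda,\pi,\eta,N)$: compute $\widetilde\pi_\lambda=\mathrm{NPG}_{Sub}(\lambda,\pi,\eta,N)$ and return $U_g^{\widetilde\pi_\lambda}(\rho)-b$. Bisection Method with NPG Subroutine. Let $B=(V_\tau^\star-V_\tau^{\overline\pi}(\rho))/\xi$. Input: a policy $\pi\in\Pi$, $p_0=0$, $q_0=B$, step-size $\eta$, iteration numbers $N_1,N_2$,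 threshold $\varepsilon>0$. It is assumed that $\nabla D(0)<0<\nabla D(B)$; otherwise the dual variable is set to the optimal endpoint ($\lambda=0$ if $\nabla D(0)\ge0$, $\lambda=B$ if $\nabla D(B)\le0$) and the loop is skipped. For $t=0,1,2,\dots$: let $\lambda=(p_t+q_t)/2$ and $h=\mathrm{Grad}_{Sub}(\lambda,\pi,\eta,N_1)$; if $|h|<\varepsilon$, break; if $h\ge\varepsilon$, set $(p_{t+1},q_{t+1})=(p_t,\lambda)$; otherwise set $(p_{t+1},q_{t+1})=(\lambda,q_t)$. Finally return $\lambda$ and the policy $\mathrm{NPG}_{Sub}(\lambda,\pi,\eta,N_2)$. All value, utility and $Q$-functions are evaluated exactly. The number of iterations is the total number of NPG updates: (number of bisection steps)$\times N_1+N_2$. Conventions: "problem-dependent" constants depend only on the CMDP data, $\rho,\tau,d,\overline\pi,\xi$ (not on $\varepsilon_0,\varepsilon_1$); the $\mathcal O(\cdot)$ is as $\varepsilon_0,\varepsilon_1\to0$ with implied constant depending only on the problem. *)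

theory Defs
  imports "HOL-Probability.Probability" "HOL-Library.Landau_Symbols"
begin

record ('s, 'a) cmdp =
  trans :: "'s \<Rightarrow> 'a \<Rightarrow> 's pmf"
  reward :: "'s \<Rightarrow> 'a \<Rightarrow> real"
  utility :: "'s \<Rightarrow> 'a \<Rightarrow> real"
  threshold :: real
  discount :: real
  init :: "'s pmf"

definition wf_cmdp :: "('s::finite, 'a::finite) cmdp \<Rightarrow> bool" where
  "wf_cmdp M \<longleftrightarrow>
     (\<forall>s a. reward M s a \<in> {0..1}) \<and> (\<forall>s a. utility M s a \<in> {0..1}) \<and>
     discount M \<in> {0..<1} \<and> threshold M \<in> {0..1 / (1 - discount M)}"

type_synonym ('s, 'a) policy = "'s \<Rightarrow> 'a pmf"

text \<open>Meaningful for nonnegative weights that are not all zero; all uses below have positive weights.\<close>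

definition normalize_weights :: "('a::finite \<Rightarrow> real) \<Rightarrow> 'a pmf" where
  "normalize_weights w = embed_pmf (\<lambda>a. w a / (\<Sum>a'\<in>UNIV. w a'))"

definition softmax :: "('s \<Rightarrow> 'a::finite \<Rightarrow> real) \<Rightarrow> ('s, 'a) policy" where
  "softmax \<theta> s = normalize_weights (\<lambda>a. exp (\<theta> s a))"

definition softmax_policies :: "('s, 'a::finite) policy set" where
  "softmax_policies = range softmax"

definition policy_vec :: "('s::finite, 'a::finite) policy \<Rightarrow> real ^ ('s \<times> 'a)" where
  "policy_vec \<pi> = (\<chi> sa. pmf (\<pi> (fst sa)) (snd sa))"


subsection \<open>Trajectories\<close>

text \<open>A trajectory is a sequence of state-action pairs. Its law under a policy and an initial state
  distribution is the measure with the one-step conditional laws below, given by the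
  Ionescu-Tulcea construction.\<close>

definition traj_kernel ::
    "('s, 'a) cmdp \<Rightarrow> ('s, 'a) policy \<Rightarrow> 's pmf \<Rightarrow> nat \<Rightarrow> (nat \<Rightarrow> 's \<times> 'a) \<Rightarrow> ('s \<times> 'a) measure" where
  "traj_kernel M \<pi> \<mu> n \<omega> = measure_pmf
     (bind_pmf (case n of 0 \<Rightarrow> \<mu> | Suc m \<Rightarrow> trans M (fst (\<omega> m)) (snd (\<omega> m)))
        (\<lambda>s. map_pmf (Pair s) (\<pi> s)))"

definition traj ::
    "('s, 'a) cmdp \<Rightarrow> ('s, 'a) policy \<Rightarrow> 's pmf \<Rightarrow> (nat \<Rightarrow> 's \<times> 'a) measure" where
  "traj M \<pi> \<mu> = projective_family.lim UNIV
     (Ionescu_Tulcea.CI (traj_kernel M \<pi> \<mu>) (\<lambda>_. count_space UNIV)) (\<lambda>_. count_space UNIV)"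

lemma Ionescu_Tulcea_traj_kernel:
  fixes M :: "('s::finite, 'a::finite) cmdp"
  shows "Ionescu_Tulcea (traj_kernel M \<pi> \<mu>) (\<lambda>_. count_space UNIV)"
proof (rule Ionescu_Tulcea.intro)
  fix n
  let ?K = "\<lambda>sa. measure_pmf (bind_pmf (trans M (fst sa) (snd sa)) (\<lambda>s. map_pmf (Pair s) (\<pi> s)))"
  have "(\<lambda>\<omega>. ?K (\<omega> m)) \<in> measurable (PiM {0..<Suc m} (\<lambda>_. count_space UNIV))
          (subprob_algebra (count_space UNIV))" for m
    by (rule measurable_compose[OF measurable_component_singleton])
      (auto simp: measure_pmf_in_subprob_algebra)
  then show "traj_kernel M \<pi> \<mu> n \<in> measurable (PiM {0..<n} (\<lambda>_. count_space UNIV))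
          (subprob_algebra (count_space UNIV))"
    by (cases n) (simp_all add: traj_kernel_def[abs_def] measure_pmf_in_subprob_algebra)
next
  fix n and \<omega> :: "nat \<Rightarrow> 's \<times> 'a"
  assume "\<omega> \<in> space (PiM {0..<n} (\<lambda>_. count_space UNIV))"
  show "prob_space (traj_kernel M \<pi> \<mu> n \<omega>)"
    by (simp add: traj_kernel_def measure_pmf.prob_space_axioms)
qed

definition discounted_return ::
    "('s, 'a) cmdp \<Rightarrow> ('s, 'a) policy \<Rightarrow> 's pmf \<Rightarrow> ('s \<Rightarrow> 'a \<Rightarrow> real) \<Rightarrow> real" where
  "discounted_return M \<pi> \<mu> f =
     (\<integral>\<omega>. (\<Sum>t. discount M ^ t * f (fst (\<omega> t)) (snd (\<omega> t))) \<partial>traj M \<pi> \<mu>)"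

definition U_val :: "('s, 'a) cmdp \<Rightarrow> ('s, 'a) policy \<Rightarrow> real" where
  "U_val M \<pi> = discounted_return M \<pi> (init M) (utility M)"

definition entropy_val :: "('s, 'a) cmdp \<Rightarrow> ('s, 'a) policy \<Rightarrow> 's pmf \<Rightarrow> real" where
  "entropy_val M \<pi> \<mu> = discounted_return M \<pi> \<mu> (\<lambda>s a. - ln (pmf (\<pi> s) a))"

definition reg_value ::
    "('s, 'a) cmdp \<Rightarrow> real \<Rightarrow> ('s \<Rightarrow> 'a \<Rightarrow> real) \<Rightarrow> ('s, 'a) policy \<Rightarrow> 's pmf \<Rightarrow> real" where
  "reg_value M \<tau> f \<pi> \<mu> = discounted_return M \<pi> \<mu> f + \<tau> * entropy_val M \<pi> \<mu>"

definition V_reg :: "('s, 'a) cmdp \<Rightarrow> real \<Rightarrow> ('s, 'a) policy \<Rightarrow> real" where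
  "V_reg M \<tau> \<pi> = reg_value M \<tau> (reward M) \<pi> (init M)"

definition visitation :: "('s, 'a) cmdp \<Rightarrow> ('s, 'a) policy \<Rightarrow> 's pmf \<Rightarrow> 's \<Rightarrow> real" where
  "visitation M \<pi> \<mu> s = (1 - discount M) *
     (\<Sum>t. discount M ^ t * measure (traj M \<pi> \<mu>) {\<omega>. fst (\<omega> t) = s})"


subsection \<open>Primal and dual problems\<close>

definition primal_optimal :: "('s, 'a::finite) cmdp \<Rightarrow> real \<Rightarrow> ('s, 'a) policy \<Rightarrow> bool" where
  "primal_optimal M \<tau> =
     is_arg_max (V_reg M \<tau>) (\<lambda>\<pi>. \<pi> \<in> softmax_policies \<and> U_val M \<pi> \<ge> threshold M)"

definition lagrangian :: "('s, 'a) cmdp \<Rightarrow> real \<Rightarrow> ('s, 'a) policy \<Rightarrow> real \<Rightarrow> real" where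
  "lagrangian M \<tau> \<pi> l = V_reg M \<tau> \<pi> + l * (U_val M \<pi> - threshold M)"

definition dual :: "('s, 'a::finite) cmdp \<Rightarrow> real \<Rightarrow> real \<Rightarrow> real" where
  "dual M \<tau> l = (SUP \<pi>\<in>softmax_policies. lagrangian M \<tau> \<pi> l)"

definition dual_opt :: "('s, 'a::finite) cmdp \<Rightarrow> real \<Rightarrow> real" where
  "dual_opt M \<tau> = (INF l\<in>{0..}. dual M \<tau> l)"


subsection \<open>Natural policy gradient and bisection\<close>

definition reward_lam :: "('s, 'a) cmdp \<Rightarrow> real \<Rightarrow> 's \<Rightarrow> 'a \<Rightarrow> real" where
  "reward_lam M l s a = reward M s a + l * utility M s a"

definition Q_lam :: "('s, 'a) cmdp \<Rightarrow> real \<Rightarrow> real \<Rightarrow> ('s, 'a) policy \<Rightarrow> 's \<Rightarrow> 'a \<Rightarrow> real" where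
  "Q_lam M \<tau> l \<pi> s a = reward_lam M l s a +
     discount M * measure_pmf.expectation (trans M s a)
       (\<lambda>s'. reg_value M \<tau> (reward_lam M l) \<pi> (return_pmf s'))"

definition npg_step ::
    "('s, 'a::finite) cmdp \<Rightarrow> real \<Rightarrow> real \<Rightarrow> real \<Rightarrow> ('s, 'a) policy \<Rightarrow> ('s, 'a) policy" where
  "npg_step M \<tau> \<eta> l \<pi> s = normalize_weights
     (\<lambda>a. pmf (\<pi> s) a powr (1 - \<eta> * \<tau> / (1 - discount M)) *
          exp (\<eta> * Q_lam M \<tau> l \<pi> s a / (1 - discount M)))"

definition npg_sub ::
    "('s, 'a::finite) cmdp \<Rightarrow> real \<Rightarrow> real \<Rightarrow> real \<Rightarrow> ('s, 'a) policy \<Rightarrow> nat \<Rightarrow> ('s, 'a) policy" where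
  "npg_sub M \<tau> \<eta> l \<pi> N = (npg_step M \<tau> \<eta> l ^^ N) \<pi>"

definition grad_sub ::
    "('s, 'a::finite) cmdp \<Rightarrow> real \<Rightarrow> real \<Rightarrow> real \<Rightarrow> ('s, 'a) policy \<Rightarrow> nat \<Rightarrow> real" where
  "grad_sub M \<tau> \<eta> l \<pi> N = U_val M (npg_sub M \<tau> \<eta> l \<pi> N) - threshold M"

text \<open>\<open>bisection_loop h \<epsilon> p q k l\<close>: started on the bracket \<open>(p, q)\<close> with gradient oracle \<open>h\<close>,
  the loop breaks with dual variable \<open>l\<close> during its \<open>k\<close>-th pass (so \<open>h\<close> is called \<open>k\<close> times).
  A loop that never breaks is not related to any \<open>k\<close> and \<open>l\<close>.\<close>

inductive bisection_loop :: "(real \<Rightarrow> real) \<Rightarrow> real \<Rightarrow> real \<Rightarrow> real \<Rightarrow> nat \<Rightarrow> real \<Rightarrow> bool"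
  for h :: "real \<Rightarrow> real" and \<epsilon> :: real where
  break: "\<bar>h ((p + q) / 2)\<bar> < \<epsilon> \<Longrightarrow> bisection_loop h \<epsilon> p q 1 ((p + q) / 2)"
| left: "\<not> \<bar>h ((p + q) / 2)\<bar> < \<epsilon> \<Longrightarrow> h ((p + q) / 2) \<ge> \<epsilon> \<Longrightarrow>
    bisection_loop h \<epsilon> p ((p + q) / 2) k l \<Longrightarrow> bisection_loop h \<epsilon> p q (Suc k) l"
| right: "\<not> \<bar>h ((p + q) / 2)\<bar> < \<epsilon> \<Longrightarrow> \<not> h ((p + q) / 2) \<ge> \<epsilon> \<Longrightarrow>
    bisection_loop h \<epsilon> ((p + q) / 2) q k l \<Longrightarrow> bisection_loop h \<epsilon> p q (Suc k) l"

text \<open>\<open>bisection_npg M \<tau> \<eta> B \<epsilon> N1 N2 \<pi>0 \<pi> l n\<close>: with input policy \<open>\<pi>0\<close> the method terminates and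
  returns \<open>(\<pi>, l)\<close> after \<open>n\<close> NPG updates in total.\<close>

definition bisection_npg ::
    "('s, 'a::finite) cmdp \<Rightarrow> real \<Rightarrow> real \<Rightarrow> real \<Rightarrow> real \<Rightarrow> nat \<Rightarrow> nat \<Rightarrow>
     ('s, 'a) policy \<Rightarrow> ('s, 'a) policy \<Rightarrow> real \<Rightarrow> nat \<Rightarrow> bool" where
  "bisection_npg M \<tau> \<eta> B \<epsilon> N1 N2 \<pi>0 \<pi> l n \<longleftrightarrow>
     (\<exists>k. (if deriv (dual M \<tau>) 0 \<ge> 0 then k = 0 \<and> l = 0
           else if deriv (dual M \<tau>) B \<le> 0 then k = 0 \<and> l = B
           else bisection_loop (\<lambda>x. grad_sub M \<tau> \<eta> x \<pi>0 N1) \<epsilon> 0 B k l) \<and>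
          \<pi> = npg_sub M \<tau> \<eta> l \<pi>0 N2 \<and> n = k * N1 + N2)"

end

theory Submission
  imports Defs
begin

text \<open>At the step size \<open>(1 - \<gamma>) / \<tau>\<close> an NPG step is a soft policy iteration step: the new policy is
  the softmax of \<open>Q / \<tau>\<close>. It contracts the gap to the optimal soft value by \<open>\<gamma>\<close>, uniformly in the
  starting policy because the entropy-regularized values are bounded.

  By the performance difference identity, the suboptimality of \<open>\<pi>\<close> for the Lagrangian at \<open>\<lambda>\<close> is a
  visitation-weighted relative entropy to the maximizer \<open>\<pi>\<^sub>\<lambda>\<close>. Under exploration this gives quadratic
  growth in \<open>\<parallel>\<pi> - \<pi>\<^sub>\<lambda>\<parallel>\<close>, which has two consequences. First, \<open>\<lambda> \<mapsto> \<pi>\<^sub>\<lambda>\<close> is Lipschitz, so the dual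
  function has the Lipschitz gradient \<open>U(\<pi>\<^sub>\<lambda>) - b\<close> and bisection with an inexact gradient stops after
  logarithmically many steps. Second, \<open>\<pi>\<^sup>\<star>\<close> is an \<open>\<epsilon>\<^sub>0\<close>-maximizer of the Lagrangian at every \<open>\<lambda> \<ge> 0\<close> with
  dual gap at most \<open>\<epsilon>\<^sub>0\<close>, so \<open>\<pi>\<^sub>\<lambda>\<close> is within \<open>O(\<surd>\<epsilon>\<^sub>0)\<close> of \<open>\<pi>\<^sup>\<star>\<close>.\<close>

subsection \<open>The law of a trajectory\<close>

definition state_step :: "('s, 'a) cmdp \<Rightarrow> ('s, 'a) policy \<Rightarrow> 's pmf \<Rightarrow> 's pmf" where
  "state_step M \<pi> \<nu> = bind_pmf \<nu> (\<lambda>s. bind_pmf (\<pi> s) (trans M s))"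

definition state_law :: "('s, 'a) cmdp \<Rightarrow> ('s, 'a) policy \<Rightarrow> nat \<Rightarrow> 's pmf \<Rightarrow> 's pmf" where
  "state_law M \<pi> t = state_step M \<pi> ^^ t"

definition with_action :: "('s, 'a) policy \<Rightarrow> 's pmf \<Rightarrow> ('s \<times> 'a) pmf" where
  "with_action \<pi> \<nu> = bind_pmf \<nu> (\<lambda>s. map_pmf (Pair s) (\<pi> s))"

lemma with_action_state_step:
  "with_action \<pi> (state_step M \<pi> \<nu>) =
     bind_pmf (with_action \<pi> \<nu>) (\<lambda>x. with_action \<pi> (trans M (fst x) (snd x)))"
  by (simp add: with_action_def state_step_def bind_assoc_pmf bind_map_pmf)

lemma traj_kernel_eq:
  "traj_kernel M \<pi> \<mu> n \<omega> = measure_pmf (with_action \<pi>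
     (case n of 0 \<Rightarrow> \<mu> | Suc m \<Rightarrow> trans M (fst (\<omega> m)) (snd (\<omega> m))))"
  by (simp add: traj_kernel_def with_action_def)

text \<open>Reduces the Ionescu-Tulcea measure to the finite chain \<open>state_law\<close>: returns
  and visitations only involve marginals at a single time. The marginal is read off the law of a
  finite prefix, computed by induction on its length.\<close>

lemma distr_traj:
  fixes M :: "('s::finite, 'a::finite) cmdp"
  shows "distr (traj M \<pi> \<mu>) (count_space UNIV) (\<lambda>\<omega>. \<omega> t) =
    measure_pmf (with_action \<pi> (state_law M \<pi> t \<mu>))"
proof -
  let ?N = "\<lambda>_ :: nat. count_space (UNIV :: ('s \<times> 'a) set)"
  interpret IT: Ionescu_Tulcea "traj_kernel M \<pi> \<mu>" ?N
    by (rule Ionescu_Tulcea_traj_kernel)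
  \<comment> \<open>\<open>?C n\<close> is the law of the first \<open>n\<close> coordinates;
    \<open>undefined\<close> is the only point of the empty product from which it starts.\<close>
  let ?C = "\<lambda>n. IT.C 0 n (\<lambda>x. undefined)"
  have meas: "(\<lambda>\<omega>. f (\<omega> t)) \<in> borel_measurable (PiM {0..<Suc t} ?N)"
    for f :: "'s \<times> 'a \<Rightarrow> ennreal" and t
    by (rule measurable_compose[OF measurable_component_singleton]) auto
  \<comment> \<open>Coordinate \<open>t\<close> is the one appended by the last kernel, so its
    integral averages that kernel over prefixes of length \<open>t\<close>.\<close>
  have step: "(\<integral>\<^sup>+\<omega>. f (\<omega> t) \<partial>?C (Suc t)) = (\<integral>\<^sup>+\<omega>. \<integral>\<^sup>+x. f x \<partial>traj_kernel M \<pi> \<mu> t \<omega> \<partial>?C t)"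
    for f :: "'s \<times> 'a \<Rightarrow> ennreal" and t
    using IT.measurable_eP[of t]
    by (auto simp: nn_integral_bind[where B="PiM {0 ..< Suc t} ?N"] IT.space_C IT.nn_integral_eP meas
           measurable_cong_sets[OF IT.sets_C] intro!: nn_integral_cong)
  \<comment> \<open>\<open>f\<close> must stay arbitrary: the induction step replaces it by its
    average under the kernel, which by the Markov property depends on the preceding coordinate
    alone.\<close>
  have C: "(\<integral>\<^sup>+\<omega>. f (\<omega> t) \<partial>?C (Suc t)) = (\<integral>\<^sup>+x. f x \<partial>with_action \<pi> (state_law M \<pi> t \<mu>))"
    for f :: "'s \<times> 'a \<Rightarrow> ennreal"
  proof (induction t arbitrary: f)
    case 0
    have "prob_space (?C 0)" by (rule IT.prob_space_C) simp
    then show ?case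
      unfolding step by (simp add: traj_kernel_eq state_law_def prob_space.emeasure_space_1 del: IT.C.simps)
  next
    case (Suc t)
    show ?case
      unfolding step[where t="Suc t"]
      by (simp add: traj_kernel_eq state_law_def with_action_state_step
        Suc[unfolded state_law_def, of "\<lambda>x. \<integral>\<^sup>+y. f y \<partial>with_action \<pi> (trans M (fst x) (snd x))"]
        del: IT.C.simps)
  qed
  show ?thesis
  proof (rule measure_eqI)
    fix A :: "('s \<times> 'a) set"
    let ?J = "{0..<Suc t}"
    \<comment> \<open>The limit measure is specified on cylinders, so the event is written as one
      about the first \<open>t + 1\<close> coordinates.\<close>
    let ?X = "{\<omega> \<in> space (PiM ?J ?N). \<omega> t \<in> A}"
    have X: "?X \<in> sets (PiM ?J ?N)"
      using measurable_sets[OF measurable_component_singleton[of t ?J ?N], of A]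
      by (simp add: vimage_def Int_def conj_commute)
    have "emeasure (distr (traj M \<pi> \<mu>) (count_space UNIV) (\<lambda>\<omega>. \<omega> t)) A
        = emeasure IT.PF.lim ((\<lambda>\<omega>. \<omega> t) -` A \<inter> space IT.PF.lim)"
      unfolding traj_def by (subst emeasure_distr)
        (auto simp: measurable_cong_sets[OF IT.PF.sets_lim refl] intro: measurable_component_singleton)
    also have "(\<lambda>\<omega>. \<omega> t) -` A \<inter> space IT.PF.lim = IT.PF.emb UNIV ?J ?X"
      by (auto simp: prod_emb_def space_PiM IT.PF.space_lim)
    also have "emeasure IT.PF.lim \<dots> = ?C (Suc t) (IT.PF.emb ?J ?J ?X)"
      using X by (subst IT.lim) (auto intro!: IT.emeasure_CI simp del: IT.C.simps)
    also have "IT.PF.emb ?J ?J ?X = ?X"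
      by (rule prod_emb_id) (unfold space_PiM, blast)
    also have "?C (Suc t) ?X = (\<integral>\<^sup>+\<omega>. indicator ?X \<omega> \<partial>?C (Suc t))"
      using X by (subst nn_integral_indicator) (auto simp: IT.sets_C simp del: IT.C.simps)
    also have "\<dots> = (\<integral>\<^sup>+\<omega>. indicator A (\<omega> t) \<partial>?C (Suc t))"
      by (intro nn_integral_cong) (auto simp: IT.space_C indicator_def simp del: IT.C.simps)
    also have "\<dots> = emeasure (measure_pmf (with_action \<pi> (state_law M \<pi> t \<mu>))) A"
      unfolding C by simp
    finally show "emeasure (distr (traj M \<pi> \<mu>) (count_space UNIV) (\<lambda>\<omega>. \<omega> t)) A = \<dots>" .
  qed simp
qed

lemma measurable_traj_coord:
  fixes M :: "('s::finite, 'a::finite) cmdp"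
  shows "(\<lambda>\<omega>. \<omega> t) \<in> measurable (traj M \<pi> \<mu>) (count_space UNIV)"
proof -
  interpret IT: Ionescu_Tulcea "traj_kernel M \<pi> \<mu>" "\<lambda>_ :: nat. count_space (UNIV :: ('s \<times> 'a) set)"
    by (rule Ionescu_Tulcea_traj_kernel)
  show ?thesis
    unfolding traj_def
    by (subst measurable_cong_sets[OF IT.PF.sets_lim refl]) (rule measurable_component_singleton, simp)
qed

lemma space_traj:
  fixes M :: "('s::finite, 'a::finite) cmdp"
  shows "space (traj M \<pi> \<mu>) = UNIV"
proof -
  interpret IT: Ionescu_Tulcea "traj_kernel M \<pi> \<mu>" "\<lambda>_ :: nat. count_space (UNIV :: ('s \<times> 'a) set)"
    by (rule Ionescu_Tulcea_traj_kernel)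
  show ?thesis
    unfolding traj_def IT.PF.space_lim by (simp add: space_PiM)
qed

lemma prob_space_traj:
  fixes M :: "('s::finite, 'a::finite) cmdp"
  shows "prob_space (traj M \<pi> \<mu>)"
  by (rule prob_space_distrD[OF measurable_traj_coord[of 0]])
     (simp add: distr_traj measure_pmf.prob_space_axioms)

section \<open>Returns and visitations as discounted series over a finite chain\<close>

definition expect :: "('s::finite, 'a::finite) policy \<Rightarrow> ('s \<Rightarrow> 'a \<Rightarrow> real) \<Rightarrow> 's \<Rightarrow> real" where
  "expect \<pi> f s = (\<Sum>a\<in>UNIV. pmf (\<pi> s) a * f s a)"

lemma integral_pmf_finite:
  fixes f :: "'x::finite \<Rightarrow> real"
  shows "measure_pmf.expectation p f = (\<Sum>x\<in>UNIV. pmf p x * f x)"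
  by (subst integral_measure_pmf[of UNIV]) auto

lemma integral_bind_pmf_finite:
  fixes f :: "'y::finite \<Rightarrow> real" and p :: "'x::finite pmf"
  shows "measure_pmf.expectation (bind_pmf p g) f =
    measure_pmf.expectation p (\<lambda>x. measure_pmf.expectation (g x) f)"
proof -
  have "measure_pmf.expectation (bind_pmf p g) f
      = (\<Sum>y\<in>UNIV. \<Sum>x\<in>UNIV. pmf p x * (pmf (g x) y * f y))"
    by (simp add: integral_pmf_finite pmf_bind sum_distrib_right mult.assoc)
  also have "\<dots> = (\<Sum>x\<in>UNIV. \<Sum>y\<in>UNIV. pmf p x * (pmf (g x) y * f y))"
    by (rule sum.swap)
  finally show ?thesis
    by (simp add: integral_pmf_finite sum_distrib_left)
qed

lemma integral_traj_coord:
  fixes M :: "('s::finite, 'a::finite) cmdp" and f :: "'s \<Rightarrow> 'a \<Rightarrow> real"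
  shows "(\<integral>\<omega>. f (fst (\<omega> t)) (snd (\<omega> t)) \<partial>traj M \<pi> \<mu>) =
    measure_pmf.expectation (state_law M \<pi> t \<mu>) (expect \<pi> f)"
proof -
  have "(\<integral>\<omega>. f (fst (\<omega> t)) (snd (\<omega> t)) \<partial>traj M \<pi> \<mu>) =
      (\<integral>x. f (fst x) (snd x) \<partial>distr (traj M \<pi> \<mu>) (count_space UNIV) (\<lambda>\<omega>. \<omega> t))"
    by (rule integral_distr[OF measurable_traj_coord, symmetric]) simp
  also have "\<dots> = measure_pmf.expectation (state_law M \<pi> t \<mu>)
      (\<lambda>s. measure_pmf.expectation (\<pi> s) (f s))"
    by (simp add: distr_traj with_action_def integral_bind_pmf_finite)
  finally show ?thesis
    by (simp add: integral_pmf_finite[of "\<pi> _"] expect_def[abs_def])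
qed

lemma abs_integral_pmf_le:
  fixes f :: "'x::finite \<Rightarrow> real"
  assumes "\<And>x. \<bar>f x\<bar> \<le> c"
  shows "\<bar>measure_pmf.expectation p f\<bar> \<le> c"
proof -
  have "\<bar>measure_pmf.expectation p f\<bar> \<le> (\<Sum>x\<in>UNIV. pmf p x * c)"
    unfolding integral_pmf_finite
    by (rule order.trans[OF sum_abs]) (auto simp: abs_mult intro!: sum_mono mult_left_mono assms)
  also have "\<dots> = c"
    by (simp add: sum_distrib_right[symmetric] sum_pmf_eq_1)
  finally show ?thesis .
qed

lemma finite_fun_bounded:
  fixes f :: "'x::finite \<Rightarrow> real"
  obtains c where "c \<ge> 0" "\<And>x. \<bar>f x\<bar> \<le> c"
proof
  show "(\<Sum>x\<in>UNIV. \<bar>f x\<bar>) \<ge> 0" by (simp add: sum_nonneg)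
  show "\<bar>f x\<bar> \<le> (\<Sum>x\<in>UNIV. \<bar>f x\<bar>)" for x
    by (rule member_le_sum) auto
qed

lemma summable_geometric_bounded:
  fixes g :: real
  assumes "0 \<le> g" "g < 1" "\<And>t. \<bar>u t\<bar> \<le> c"
  shows "summable (\<lambda>t. g ^ t * u t :: real)"
proof (rule summable_comparison_test')
  show "summable (\<lambda>t. g ^ t * c)"
    using assms by (intro summable_mult2 summable_geometric) auto
  show "norm (g ^ t * u t) \<le> g ^ t * c" if "t \<ge> 0" for t
    using assms by (auto simp: abs_mult intro!: mult_left_mono)
qed

text \<open>Finiteness of the state and action spaces bounds every \<open>f\<close>, the logarithmic
  entropy term included, so the geometric series dominates and sum and integral may be
  exchanged.\<close>

lemma discounted_return_eq:
  fixes M :: "('s::finite, 'a::finite) cmdp"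
  assumes g: "discount M \<in> {0..<1}"
  shows "discounted_return M \<pi> \<mu> f =
    (\<Sum>t. discount M ^ t * measure_pmf.expectation (state_law M \<pi> t \<mu>) (expect \<pi> f))"
proof -
  interpret prob_space "traj M \<pi> \<mu>" by (rule prob_space_traj)
  obtain c where c: "c \<ge> 0" "\<And>x. \<bar>f (fst x) (snd x)\<bar> \<le> c"
    using finite_fun_bounded[of "\<lambda>x. f (fst x) (snd x)"] by metis
  have meas: "(\<lambda>\<omega>. f (fst (\<omega> t)) (snd (\<omega> t))) \<in> borel_measurable (traj M \<pi> \<mu>)" for t
    by (rule measurable_compose[OF measurable_traj_coord]) simp
  have int: "integrable (traj M \<pi> \<mu>) (\<lambda>\<omega>. discount M ^ t * f (fst (\<omega> t)) (snd (\<omega> t)))" for t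
    by (intro integrable_mult_right integrable_const_bound[of _ c])
       (auto simp: c meas)
  have "discounted_return M \<pi> \<mu> f
      = (\<Sum>t. \<integral>\<omega>. discount M ^ t * f (fst (\<omega> t)) (snd (\<omega> t)) \<partial>traj M \<pi> \<mu>)"
    unfolding discounted_return_def
  proof (rule integral_suminf[OF int])
    show "AE \<omega> in traj M \<pi> \<mu>. summable (\<lambda>t. norm (discount M ^ t * f (fst (\<omega> t)) (snd (\<omega> t))))"
      using g c by (intro always_eventually allI) (auto simp: abs_mult intro!: summable_geometric_bounded[of _ _ c])
    have "(\<integral>\<omega>. \<bar>f (fst (\<omega> t)) (snd (\<omega> t))\<bar> \<partial>traj M \<pi> \<mu>) =
        measure_pmf.expectation (state_law M \<pi> t \<mu>) (expect \<pi> (\<lambda>s a. \<bar>f s a\<bar>))" for t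
      by (rule integral_traj_coord)
    moreover have "\<bar>expect \<pi> (\<lambda>s a. \<bar>f s a\<bar>) s\<bar> \<le> c" for s
      using abs_integral_pmf_le[of "\<lambda>a. \<bar>f s a\<bar>" c "\<pi> s"] c(2)[of "(s, _)"]
      by (simp add: expect_def integral_pmf_finite)
    ultimately have "summable (\<lambda>t. discount M ^ t * (\<integral>\<omega>. \<bar>f (fst (\<omega> t)) (snd (\<omega> t))\<bar> \<partial>traj M \<pi> \<mu>))"
      using g by (intro summable_geometric_bounded[of _ _ c]) (auto intro!: abs_integral_pmf_le)
    then show "summable (\<lambda>t. \<integral>\<omega>. norm (discount M ^ t * f (fst (\<omega> t)) (snd (\<omega> t))) \<partial>traj M \<pi> \<mu>)"
      using g by (simp add: abs_mult)
  qed
  then show ?thesis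
    by (simp add: integral_traj_coord)
qed

lemma visitation_eq:
  fixes M :: "('s::finite, 'a::finite) cmdp"
  shows "visitation M \<pi> \<mu> s = (1 - discount M) *
     (\<Sum>t. discount M ^ t * pmf (state_law M \<pi> t \<mu>) s)"
proof -
  have "measure (traj M \<pi> \<mu>) {\<omega>. fst (\<omega> t) = s} = pmf (state_law M \<pi> t \<mu>) s" for t
  proof -
    have "measure (traj M \<pi> \<mu>) {\<omega>. fst (\<omega> t) = s}
        = measure (distr (traj M \<pi> \<mu>) (count_space UNIV) (\<lambda>\<omega>. \<omega> t)) {x. fst x = s}"
      by (subst measure_distr[OF measurable_traj_coord]) (auto simp: space_traj vimage_def)
    also have "\<dots> = measure_pmf.prob (map_pmf fst (with_action \<pi> (state_law M \<pi> t \<mu>))) {s}"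
      by (simp add: distr_traj vimage_def)
    also have "map_pmf fst (with_action \<pi> (state_law M \<pi> t \<mu>)) = state_law M \<pi> t \<mu>"
      by (simp add: with_action_def map_bind_pmf map_pmf_comp bind_return_pmf')
    finally show ?thesis by (simp add: pmf.rep_eq)
  qed
  then show ?thesis by (simp add: visitation_def)
qed

subsection \<open>Bellman equation and performance difference\<close>

lemma expect_le:
  assumes "\<And>a. f s a \<le> h s a"
  shows "expect \<pi> f s \<le> expect \<pi> h s"
  unfolding expect_def by (intro sum_mono mult_left_mono assms) auto

lemma expect_const [simp]: "expect \<pi> (\<lambda>s a. c s) s = c s"
  by (simp add: expect_def sum_distrib_right[symmetric] sum_pmf_eq_1)

lemma expect_add: "expect \<pi> (\<lambda>s a. f s a + h s a) s = expect \<pi> f s + expect \<pi> h s"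
  by (simp add: expect_def sum.distrib distrib_left)

lemma expect_diff: "expect \<pi> (\<lambda>s a. f s a - h s a) s = expect \<pi> f s - expect \<pi> h s"
  by (simp add: expect_def sum_subtractf right_diff_distrib)

lemma expect_cmult: "expect \<pi> (\<lambda>s a. c * f s a) s = c * expect \<pi> f s"
  by (simp add: expect_def sum_distrib_left mult.left_commute)

lemma integral_pmf_mono_finite:
  fixes f :: "'x::finite \<Rightarrow> real"
  assumes "\<And>x. f x \<le> h x"
  shows "measure_pmf.expectation p f \<le> measure_pmf.expectation p h"
  unfolding integral_pmf_finite by (intro sum_mono mult_left_mono assms) auto

lemma integral_pmf_add_finite:
  fixes f :: "'x::finite \<Rightarrow> real"
  shows "measure_pmf.expectation p (\<lambda>x. f x + h x) =
    measure_pmf.expectation p f + measure_pmf.expectation p h"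
  unfolding integral_pmf_finite by (simp add: sum.distrib distrib_left)

lemma integral_pmf_diff_finite:
  fixes f :: "'x::finite \<Rightarrow> real"
  shows "measure_pmf.expectation p (\<lambda>x. f x - h x) =
    measure_pmf.expectation p f - measure_pmf.expectation p h"
  unfolding integral_pmf_finite by (simp add: sum_subtractf right_diff_distrib)

text \<open>A one-step lookahead with an arbitrary continuation value \<open>X\<close>, so that it
  serves the evaluation of a policy, the soft Bellman operator and comparison functions
  alike.\<close>

definition action_value ::
    "('s::finite, 'a::finite) cmdp \<Rightarrow> ('s \<Rightarrow> 'a \<Rightarrow> real) \<Rightarrow> ('s \<Rightarrow> real) \<Rightarrow> 's \<Rightarrow> 'a \<Rightarrow> real" where
  "action_value M f X s a = f s a + discount M * measure_pmf.expectation (trans M s a) X"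

definition state_value ::
    "('s::finite, 'a::finite) cmdp \<Rightarrow> ('s, 'a) policy \<Rightarrow> ('s \<Rightarrow> 'a \<Rightarrow> real) \<Rightarrow> 's \<Rightarrow> real" where
  "state_value M \<pi> f s = discounted_return M \<pi> (return_pmf s) f"

lemma expectation_state_step:
  fixes X :: "'s::finite \<Rightarrow> real" and M :: "('s, 'a::finite) cmdp"
  shows "measure_pmf.expectation (state_step M \<pi> \<nu>) X =
    measure_pmf.expectation \<nu> (expect \<pi> (\<lambda>s a. measure_pmf.expectation (trans M s a) X))"
  by (simp add: state_step_def integral_bind_pmf_finite integral_pmf_finite[of "\<pi> _"] expect_def[abs_def])

lemma state_law_0 [simp]: "state_law M \<pi> 0 \<mu> = \<mu>"
  by (simp add: state_law_def)

lemma state_law_Suc: "state_law M \<pi> (Suc t) \<mu> = state_step M \<pi> (state_law M \<pi> t \<mu>)"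
  by (simp add: state_law_def)

lemma state_law_Suc': "state_law M \<pi> (Suc t) \<mu> = state_law M \<pi> t (state_step M \<pi> \<mu>)"
  by (simp add: state_law_def funpow_swap1)

lemma state_law_bind:
  "state_law M \<pi> t (bind_pmf \<mu> f) = bind_pmf \<mu> (\<lambda>x. state_law M \<pi> t (f x))"
  by (induction t) (simp_all add: state_law_Suc state_step_def bind_assoc_pmf)

lemma expectation_state_law:
  fixes X :: "'s::finite \<Rightarrow> real"
  shows "measure_pmf.expectation (state_law M \<pi> t \<mu>) X =
    measure_pmf.expectation \<mu> (\<lambda>s. measure_pmf.expectation (state_law M \<pi> t (return_pmf s)) X)"
  by (simp add: integral_bind_pmf_finite[symmetric] state_law_bind[symmetric] bind_return_pmf')

locale discounted_mdp =
  fixes M :: "('s::finite, 'a::finite) cmdp"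
  assumes discount: "discount M \<in> {0..<1}"
begin

abbreviation "\<gamma> \<equiv> discount M"

lemma discount_nonneg [simp]: "0 \<le> \<gamma>" and discount_less_1 [simp]: "\<gamma> < 1"
  using discount by auto

lemma discount_le_1 [simp]: "\<gamma> \<le> 1" and discount_neq_1 [simp]: "\<gamma> \<noteq> 1" "1 \<noteq> \<gamma>"
  using discount_less_1 by linarith+

lemma summable_state_law:
  fixes X :: "'s \<Rightarrow> real"
  shows "summable (\<lambda>t. \<gamma> ^ t * measure_pmf.expectation (state_law M \<pi> t \<mu>) X)"
proof -
  obtain c where "c \<ge> 0" "\<And>x. \<bar>X x\<bar> \<le> c" using finite_fun_bounded[of X] by metis
  then show ?thesis
    by (intro summable_geometric_bounded abs_integral_pmf_le) simp_all
qed

lemma discounted_return_init: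
  "discounted_return M \<pi> \<mu> f = measure_pmf.expectation \<mu> (state_value M \<pi> f)"
proof -
  let ?E = "\<lambda>t s. measure_pmf.expectation (state_law M \<pi> t (return_pmf s)) (expect \<pi> f)"
  have "discounted_return M \<pi> \<mu> f = (\<Sum>t. \<Sum>s\<in>UNIV. pmf \<mu> s * (\<gamma> ^ t * ?E t s))"
    by (simp add: discounted_return_eq discount expectation_state_law[of _ _ _ \<mu>]
      integral_pmf_finite[of \<mu>] sum_distrib_left mult.left_commute)
  also have "\<dots> = (\<Sum>s\<in>UNIV. \<Sum>t. pmf \<mu> s * (\<gamma> ^ t * ?E t s))"
    by (intro suminf_sum summable_mult summable_state_law)
  also have "\<dots> = measure_pmf.expectation \<mu> (state_value M \<pi> f)"
    by (simp add: suminf_mult summable_state_law integral_pmf_finite[of \<mu>] state_value_def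
      discounted_return_eq discount)
  finally show ?thesis .
qed

text \<open>Splitting off time 0 leaves \<gamma> times the return started from the law after one
  step, which is an average of state values.\<close>

lemma state_value_bellman:
  "state_value M \<pi> f s = expect \<pi> (action_value M f (state_value M \<pi> f)) s"
proof -
  let ?\<mu> = "state_step M \<pi> (return_pmf s)"
  let ?u = "\<lambda>t. \<gamma> ^ t * measure_pmf.expectation (state_law M \<pi> t (return_pmf s)) (expect \<pi> f)"
  have "state_value M \<pi> f s = (\<Sum>t. ?u t)"
    by (simp add: state_value_def discounted_return_eq discount)
  also have "\<dots> = ?u 0 + (\<Sum>t. ?u (Suc t))"
    using suminf_split_head[OF summable_state_law[of \<pi> "return_pmf s" "expect \<pi> f"]] by simp
  also have "(\<Sum>t. ?u (Suc t)) = \<gamma> * discounted_return M \<pi> ?\<mu> f"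
    by (simp add: state_law_Suc' mult.assoc suminf_mult[OF summable_state_law] discounted_return_eq discount)
  also have "discounted_return M \<pi> ?\<mu> f
      = expect \<pi> (\<lambda>s a. measure_pmf.expectation (trans M s a) (state_value M \<pi> f)) s"
    by (simp add: discounted_return_init expectation_state_step)
  finally show ?thesis
    by (simp add: action_value_def[abs_def] expect_add expect_cmult)
qed

text \<open>Exchanging the sums over time and states trades time for the visitation distribution.
  The case \<open>X = 1\<close> shows that it has total mass 1.\<close>

lemma suminf_state_law:
  "(\<Sum>t. \<gamma> ^ t * measure_pmf.expectation (state_law M \<pi> t \<mu>) X) =
    (\<Sum>s\<in>UNIV. visitation M \<pi> \<mu> s * X s) / (1 - \<gamma>)"
proof -
  have *: "summable (\<lambda>t. \<gamma> ^ t * pmf (state_law M \<pi> t \<mu>) s)" for s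
    by (rule summable_geometric_bounded[of _ _ 1]) (auto simp: pmf_le_1)
  have "(\<Sum>t. \<gamma> ^ t * measure_pmf.expectation (state_law M \<pi> t \<mu>) X) =
      (\<Sum>t. \<Sum>s\<in>UNIV. \<gamma> ^ t * pmf (state_law M \<pi> t \<mu>) s * X s)"
    by (simp add: integral_pmf_finite sum_distrib_left mult.assoc)
  also have "\<dots> = (\<Sum>s\<in>UNIV. \<Sum>t. \<gamma> ^ t * pmf (state_law M \<pi> t \<mu>) s * X s)"
    by (intro suminf_sum summable_mult2 *)
  also have "\<dots> = (\<Sum>s\<in>UNIV. visitation M \<pi> \<mu> s / (1 - \<gamma>) * X s)"
    using discount_less_1 by (simp add: visitation_eq suminf_mult2[OF *, symmetric] del: discount_less_1)
  finally show ?thesis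
    by (simp add: sum_divide_distrib)
qed

lemma visitation_nonneg: "visitation M \<pi> \<mu> s \<ge> 0"
  unfolding visitation_eq
  by (intro mult_nonneg_nonneg suminf_nonneg summable_geometric_bounded[of _ _ 1])
     (auto simp: pmf_le_1 less_imp_le[OF discount_less_1])

lemma sum_visitation: "(\<Sum>s\<in>UNIV. visitation M \<pi> \<mu> s) = 1"
  using suminf_state_law[of \<pi> \<mu> "\<lambda>_. 1"] discount_less_1
  by (simp add: suminf_geometric del: discount_less_1)

text \<open>Along the chain of \<open>\<pi>\<close> the expected Bellman residual of
  \<open>X\<close> at time \<open>t\<close> contains \<open>X\<close> at times \<open>t\<close> and
  \<open>t + 1\<close>, so the discounted sum telescopes to its time 0 term. Since \<open>X\<close>
  is arbitrary, this one identity yields the comparison bounds, the Lipschitz estimate and quadratic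
  growth.\<close>

lemma performance_difference:
  "measure_pmf.expectation \<mu> X - discounted_return M \<pi> \<mu> f =
    (\<Sum>s\<in>UNIV. visitation M \<pi> \<mu> s * (X s - expect \<pi> (action_value M f X) s)) / (1 - \<gamma>)"
proof -
  let ?E = "\<lambda>t X. measure_pmf.expectation (state_law M \<pi> t \<mu>) X"
  note sm = summable_state_law[of \<pi> \<mu>]
  have sm': "summable (\<lambda>t. \<gamma> ^ Suc t * ?E (Suc t) X)"
    using sm[of X] by (subst summable_Suc_iff)
  have "?E t (\<lambda>s. X s - expect \<pi> (action_value M f X) s) =
      ?E t X - ?E t (expect \<pi> f) - \<gamma> * ?E (Suc t) X" for t
    by (simp add: action_value_def[abs_def] expect_add expect_cmult state_law_Suc
      expectation_state_step integral_pmf_diff_finite integral_pmf_add_finite)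
  then have "(\<Sum>t. \<gamma> ^ t * ?E t (\<lambda>s. X s - expect \<pi> (action_value M f X) s)) =
      (\<Sum>t. \<gamma> ^ t * ?E t X - \<gamma> ^ t * ?E t (expect \<pi> f) - \<gamma> ^ Suc t * ?E (Suc t) X)"
    by (simp add: right_diff_distrib mult.assoc mult.left_commute)
  also have "\<dots> = (\<Sum>t. \<gamma> ^ t * ?E t X) - (\<Sum>t. \<gamma> ^ t * ?E t (expect \<pi> f))
      - (\<Sum>t. \<gamma> ^ Suc t * ?E (Suc t) X)"
    by (subst suminf_diff[symmetric] | intro sm sm' summable_diff refl)+
  also have "(\<Sum>t. \<gamma> ^ Suc t * ?E (Suc t) X) = (\<Sum>t. \<gamma> ^ t * ?E t X) - ?E 0 X"
    using suminf_split_head[OF sm[of X]] by simp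
  finally show ?thesis
    by (simp add: discounted_return_eq discount suminf_state_law)
qed

lemma discounted_return_linear:
  "discounted_return M \<pi> \<mu> (\<lambda>s a. f s a + c * h s a) =
    discounted_return M \<pi> \<mu> f + c * discounted_return M \<pi> \<mu> h"
  unfolding discounted_return_eq[OF discount] suminf_state_law expect_add expect_cmult
  by (simp add: distrib_left sum.distrib add_divide_distrib sum_distrib_left mult.left_commute)

text \<open>Comparison principle: visitations are nonnegative, so a supersolution of the Bellman
  equation of \<open>\<pi>\<close> has nonnegative averaged residual.
  \<open>discounted_return_ge\<close> is the counterpart for subsolutions.\<close>

lemma discounted_return_le:
  assumes "\<And>s. expect \<pi> (action_value M f X) s \<le> X s"
  shows "discounted_return M \<pi> \<mu> f \<le> measure_pmf.expectation \<mu> X"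
proof -
  have "0 \<le> (\<Sum>s\<in>UNIV. visitation M \<pi> \<mu> s * (X s - expect \<pi> (action_value M f X) s)) / (1 - \<gamma>)"
    using assms by (intro divide_nonneg_nonneg sum_nonneg mult_nonneg_nonneg visitation_nonneg)
      (auto simp: less_imp_le)
  then show ?thesis unfolding performance_difference[symmetric] by simp
qed

lemma discounted_return_ge:
  assumes "\<And>s. X s \<le> expect \<pi> (action_value M f X) s"
  shows "measure_pmf.expectation \<mu> X \<le> discounted_return M \<pi> \<mu> f"
proof -
  have "(\<Sum>s\<in>UNIV. visitation M \<pi> \<mu> s * (X s - expect \<pi> (action_value M f X) s)) / (1 - \<gamma>) \<le> 0"
    using assms by (intro divide_nonpos_nonneg sum_nonpos mult_nonneg_nonpos visitation_nonneg)
      (auto simp: less_imp_le)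
  then show ?thesis unfolding performance_difference[symmetric] by simp
qed

lemma action_value_mono:
  assumes "\<And>s. X s \<le> Y s"
  shows "action_value M f X s a \<le> action_value M f Y s a"
  unfolding action_value_def
  by (intro add_left_mono mult_left_mono integral_pmf_mono_finite assms) simp

lemma action_value_shift:
  "action_value M f (\<lambda>s. X s + c) s a = action_value M f X s a + \<gamma> * c"
  by (simp add: action_value_def integral_pmf_add_finite distrib_left)

end

subsection \<open>Lipschitz dependence of unregularized values on the policy\<close>

lemma norm_policy_vec_sq:
  "(norm (policy_vec \<pi> - policy_vec \<pi>'))\<^sup>2 = (\<Sum>s\<in>UNIV. \<Sum>a\<in>UNIV. (pmf (\<pi> s) a - pmf (\<pi>' s) a)\<^sup>2)"
  unfolding norm_vec_def L2_set_def policy_vec_def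
  by (simp add: sum_nonneg sum.cartesian_product UNIV_Times_UNIV[symmetric] case_prod_beta
    del: UNIV_Times_UNIV)

text \<open>Cauchy-Schwarz over the actions; this is the source of the square root in the Lipschitz
  constant of the utility.\<close>

lemma l1_policy_le:
  fixes \<pi> :: "('s::finite, 'a::finite) policy"
  shows "(\<Sum>a\<in>UNIV. \<bar>pmf (\<pi> s) a - pmf (\<pi>' s) a\<bar>) \<le>
    sqrt (real CARD('a)) * norm (policy_vec \<pi> - policy_vec \<pi>')"
proof -
  let ?x = "\<lambda>a. pmf (\<pi> s) a - pmf (\<pi>' s) a"
  have "(\<Sum>a\<in>UNIV. \<bar>?x a\<bar> * \<bar>1\<bar>) \<le> L2_set ?x UNIV * L2_set (\<lambda>_. 1) (UNIV :: 'a set)"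
    by (rule L2_set_mult_ineq)
  moreover have "L2_set ?x UNIV \<le> norm (policy_vec \<pi> - policy_vec \<pi>')"
  proof (rule power2_le_imp_le)
    have "(\<Sum>a\<in>UNIV. (?x a)\<^sup>2) \<le> (\<Sum>s\<in>UNIV. \<Sum>a\<in>UNIV. (pmf (\<pi> s) a - pmf (\<pi>' s) a)\<^sup>2)"
      by (rule member_le_sum[of s UNIV "\<lambda>s. \<Sum>a\<in>UNIV. (pmf (\<pi> s) a - pmf (\<pi>' s) a)\<^sup>2"])
         (auto intro: sum_nonneg)
    then show "(L2_set ?x UNIV)\<^sup>2 \<le> (norm (policy_vec \<pi> - policy_vec \<pi>'))\<^sup>2"
      by (simp add: norm_policy_vec_sq L2_set_def sum_nonneg)
  qed simp
  ultimately show ?thesis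
    by (simp add: L2_set_def mult.commute) (meson mult_left_mono order_trans real_sqrt_ge_0_iff of_nat_0_le_iff)
qed

context discounted_mdp
begin

lemma discounted_return_bounds:
  assumes f: "\<And>s a. f s a \<in> {0..1}"
  shows "discounted_return M \<pi> \<mu> f \<in> {0..1 / (1 - \<gamma>)}"
proof -
  have g: "1 - \<gamma> \<noteq> 0" using discount_less_1 by linarith
  have "discounted_return M \<pi> \<mu> f \<le> measure_pmf.expectation \<mu> (\<lambda>_. 1 / (1 - \<gamma>))"
  proof (rule discounted_return_le)
    fix s
    have "expect \<pi> (action_value M f (\<lambda>_. 1 / (1 - \<gamma>))) s \<le> expect \<pi> (\<lambda>s a. 1 + \<gamma> * (1 / (1 - \<gamma>))) s"
      using f by (intro expect_le) (auto simp: action_value_def)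
    also have "\<dots> = 1 / (1 - \<gamma>)"
      using g by (simp add: field_simps)
    finally show "expect \<pi> (action_value M f (\<lambda>_. 1 / (1 - \<gamma>))) s \<le> 1 / (1 - \<gamma>)" .
  qed
  moreover have "measure_pmf.expectation \<mu> (\<lambda>_. 0) \<le> discounted_return M \<pi> \<mu> f"
  proof (rule discounted_return_ge)
    fix s
    have "expect \<pi> (\<lambda>s a. 0) s \<le> expect \<pi> (action_value M f (\<lambda>_. 0)) s"
      using f by (intro expect_le) (auto simp: action_value_def)
    then show "0 \<le> expect \<pi> (action_value M f (\<lambda>_. 0)) s" by simp
  qed
  ultimately show ?thesis by simp
qed

text \<open>With the value of \<open>\<pi>'\<close> as continuation, the residual at a state is the
  difference of the action distributions paired with a Q-function bounded by 1/(1 - \<gamma>). The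
  normalization of the visitation supplies the second such factor.\<close>

lemma discounted_return_lipschitz:
  fixes \<pi> \<pi>' :: "('s, 'a) policy"
  assumes f: "\<And>s a. f s a \<in> {0..1}"
  shows "\<bar>discounted_return M \<pi>' \<mu> f - discounted_return M \<pi> \<mu> f\<bar> \<le>
    sqrt (real CARD('a)) / (1 - \<gamma>)\<^sup>2 * norm (policy_vec \<pi> - policy_vec \<pi>')"
proof -
  let ?X = "state_value M \<pi>' f" and ?n = "sqrt (real CARD('a)) * norm (policy_vec \<pi> - policy_vec \<pi>')"
  let ?D = "\<lambda>s. ?X s - expect \<pi> (action_value M f ?X) s"
  have g: "1 - \<gamma> > 0" by simp
  have X: "?X s \<in> {0..1 / (1 - \<gamma>)}" for s
    unfolding state_value_def by (rule discounted_return_bounds[OF f])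
  have q: "\<bar>action_value M f ?X s a\<bar> \<le> 1 / (1 - \<gamma>)" for s a
  proof -
    have "\<bar>measure_pmf.expectation (trans M s a) ?X\<bar> \<le> 1 / (1 - \<gamma>)"
      using X by (intro abs_integral_pmf_le) auto
    then have "\<bar>\<gamma> * measure_pmf.expectation (trans M s a) ?X\<bar> \<le> \<gamma> * (1 / (1 - \<gamma>))"
      unfolding abs_mult by (intro mult_mono) auto
    moreover have "\<bar>f s a\<bar> \<le> 1" using f[of s a] by auto
    ultimately have "\<bar>action_value M f ?X s a\<bar> \<le> 1 + \<gamma> * (1 / (1 - \<gamma>))"
      unfolding action_value_def by linarith
    also have "\<dots> = 1 / (1 - \<gamma>)" using g by (simp add: field_simps)
    finally show ?thesis .
  qed
  have D: "\<bar>?D s\<bar> \<le> ?n / (1 - \<gamma>)" for s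
  proof -
    have "?D s = (\<Sum>a\<in>UNIV. (pmf (\<pi>' s) a - pmf (\<pi> s) a) * action_value M f ?X s a)"
      by (subst state_value_bellman) (simp add: expect_def sum_subtractf left_diff_distrib)
    also have "\<bar>\<dots>\<bar> \<le> (\<Sum>a\<in>UNIV. \<bar>pmf (\<pi> s) a - pmf (\<pi>' s) a\<bar> * (1 / (1 - \<gamma>)))"
      unfolding abs_minus_commute[of "pmf (\<pi> s) _"]
      by (rule order.trans[OF sum_abs], intro sum_mono) (unfold abs_mult, rule mult_left_mono[OF q], simp)
    also have "\<dots> \<le> ?n * (1 / (1 - \<gamma>))"
      unfolding sum_distrib_right[symmetric] using g by (intro mult_right_mono l1_policy_le) simp
    finally show ?thesis by simp
  qed
  have "\<bar>\<Sum>s\<in>UNIV. visitation M \<pi> \<mu> s * ?D s\<bar> \<le> (\<Sum>s\<in>UNIV. visitation M \<pi> \<mu> s * (?n / (1 - \<gamma>)))"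
    by (rule order.trans[OF sum_abs], intro sum_mono)
       (unfold abs_mult abs_of_nonneg[OF visitation_nonneg], rule mult_left_mono[OF D visitation_nonneg])
  also have "\<dots> = ?n / (1 - \<gamma>)"
    unfolding sum_distrib_right[symmetric] sum_visitation by simp
  finally have "\<bar>\<Sum>s\<in>UNIV. visitation M \<pi> \<mu> s * ?D s\<bar> / (1 - \<gamma>) \<le> ?n / (1 - \<gamma>) / (1 - \<gamma>)"
    using g by (intro divide_right_mono) auto
  then show ?thesis
    using performance_difference[of \<mu> ?X \<pi> f] g
    by (simp add: discounted_return_init[of \<pi>' \<mu> f] power2_eq_square)
qed

end

subsection \<open>Soft Bellman operator\<close>

lemma pmf_normalize_weights:
  fixes w :: "'a::finite \<Rightarrow> real"
  assumes "\<And>a. w a > 0"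
  shows "pmf (normalize_weights w) a = w a / (\<Sum>a'\<in>UNIV. w a')"
  unfolding normalize_weights_def
proof (rule pmf_embed_pmf)
  have pos: "(\<Sum>a\<in>UNIV. w a) > 0"
    using assms by (intro sum_pos) auto
  then show "\<And>a. 0 \<le> w a / (\<Sum>a'\<in>UNIV. w a')"
    using assms by (simp add: less_imp_le)
  then have "(\<integral>\<^sup>+a. ennreal (w a / (\<Sum>a'\<in>UNIV. w a')) \<partial>count_space UNIV)
      = ennreal (\<Sum>a\<in>UNIV. w a / (\<Sum>a'\<in>UNIV. w a'))"
    by (subst nn_integral_count_space_finite) (auto simp: sum_ennreal)
  also have "\<dots> = 1"
    using pos by (simp add: sum_divide_distrib[symmetric])
  finally show "(\<integral>\<^sup>+a. ennreal (w a / (\<Sum>a'\<in>UNIV. w a')) \<partial>count_space UNIV) = 1" .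
qed

lemma sum_exp_pos: "(\<Sum>a\<in>UNIV. exp (f (a::'a::finite)) :: real) > 0"
  by (intro sum_pos) auto

lemma pmf_softmax: "pmf (softmax \<theta> s) a = exp (\<theta> s a) / (\<Sum>a'\<in>UNIV. exp (\<theta> s a'))"
  by (simp add: softmax_def pmf_normalize_weights)

lemma pmf_softmax_policies_pos:
  assumes "\<pi> \<in> softmax_policies"
  shows "pmf (\<pi> s) a > 0"
  using assms by (auto simp: softmax_policies_def pmf_softmax intro!: divide_pos_pos sum_exp_pos)

lemma softmax_in_softmax_policies [simp]: "softmax \<theta> \<in> softmax_policies"
  by (simp add: softmax_policies_def)

text \<open>Squared Hellinger distance in place of Pinsker's inequality: with \<open>x = \<surd>p\<close> and \<open>y = \<surd>q\<close>,
  \<open>ln (y / x) \<le> y / x - 1\<close> bounds the divergence below by \<open>(x - y)\<^sup>2\<close>, and \<open>x + y \<le> 2\<close>.\<close>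

lemma relative_entropy_pointwise:
  fixes p q :: real
  assumes "0 < p" "p \<le> 1" "0 < q" "q \<le> 1"
  shows "p - q + (p - q)\<^sup>2 / 4 \<le> p * (ln p - ln q)"
proof -
  define x y where "x = sqrt p" and "y = sqrt q"
  have xy: "0 < x" "x \<le> 1" "0 < y" "y \<le> 1" and pq: "p = x\<^sup>2" "q = y\<^sup>2"
    using assms by (auto simp: x_def y_def)
  have "ln y - ln x \<le> y / x - 1"
    using ln_le_minus_one[of "y / x"] xy by (simp add: ln_div)
  then have "2 * x\<^sup>2 * (ln y - ln x) \<le> 2 * x\<^sup>2 * (y / x - 1)"
    by (intro mult_left_mono) auto
  also have "2 * x\<^sup>2 * (y / x - 1) = 2 * x * y - 2 * x\<^sup>2"
    using xy by (simp add: field_simps power2_eq_square)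
  finally have "2 * x\<^sup>2 - 2 * x * y \<le> 2 * x\<^sup>2 * (ln x - ln y)"
    by (simp add: algebra_simps)
  moreover have "(x\<^sup>2 - y\<^sup>2)\<^sup>2 \<le> 4 * (x - y)\<^sup>2"
  proof -
    have "(x + y)\<^sup>2 \<le> 2\<^sup>2" using xy by (intro power_mono) auto
    then have "(x - y)\<^sup>2 * (x + y)\<^sup>2 \<le> (x - y)\<^sup>2 * 4" by (intro mult_left_mono) auto
    then show ?thesis by (simp add: power_mult_distrib[symmetric] power2_eq_square algebra_simps)
  qed
  moreover have "2 * x\<^sup>2 - 2 * x * y = x\<^sup>2 - y\<^sup>2 + (x - y)\<^sup>2"
    by (simp add: power2_eq_square algebra_simps)
  ultimately have "x\<^sup>2 - y\<^sup>2 + (x\<^sup>2 - y\<^sup>2)\<^sup>2 / 4 \<le> 2 * x\<^sup>2 * (ln x - ln y)" by linarith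
  then show ?thesis using xy by (simp add: pq ln_realpow algebra_simps)
qed

lemma relative_entropy_ge:
  fixes p q :: "'a::finite pmf"
  assumes "\<And>a. pmf p a > 0" "\<And>a. pmf q a > 0"
  shows "(\<Sum>a\<in>UNIV. (pmf p a - pmf q a)\<^sup>2) / 4 \<le> (\<Sum>a\<in>UNIV. pmf p a * (ln (pmf p a) - ln (pmf q a)))"
proof -
  have "(\<Sum>a\<in>UNIV. pmf p a - pmf q a + (pmf p a - pmf q a)\<^sup>2 / 4)
      \<le> (\<Sum>a\<in>UNIV. pmf p a * (ln (pmf p a) - ln (pmf q a)))"
    by (intro sum_mono relative_entropy_pointwise assms pmf_le_1)
  then show ?thesis
    by (simp add: sum.distrib sum_subtractf sum_pmf_eq_1 sum_divide_distrib)
qed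

text \<open>Moving the logits by \<delta> changes numerator and normalizer by a factor of at most
  exp \<delta> each. The bounds 1 - 2\<delta> \<le> exp (-2\<delta>) and probability \<le> 1 turn
  the factor into an additive error; swapping the two logits gives the other side.\<close>

lemma softmax_close:
  fixes \<theta> \<theta>' :: "'s \<Rightarrow> 'a::finite \<Rightarrow> real"
  assumes "\<And>a. \<bar>\<theta> s a - \<theta>' s a\<bar> \<le> \<delta>"
  shows "\<bar>pmf (softmax \<theta> s) a - pmf (softmax \<theta>' s) a\<bar> \<le> 2 * \<delta>"
proof -
  have ratio: "pmf (softmax \<theta>' s) a - pmf (softmax \<theta> s) a \<le> 2 * \<delta>"
    if d: "\<And>a. \<bar>\<theta> s a - \<theta>' s a\<bar> \<le> \<delta>" for \<theta> \<theta>' :: "'s \<Rightarrow> 'a \<Rightarrow> real"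
  proof -
    let ?Z = "\<lambda>\<theta>. \<Sum>a\<in>UNIV. exp (\<theta> s a) :: real"
    have Z: "?Z \<theta> \<le> exp \<delta> * ?Z \<theta>'"
      unfolding sum_distrib_left using d by (intro sum_mono) (auto simp: exp_add[symmetric] abs_le_iff algebra_simps)
    have e: "exp (\<theta>' s a) \<le> exp \<delta> * exp (\<theta> s a)"
      using d[of a] by (auto simp: exp_add[symmetric] abs_le_iff algebra_simps)
    have d0: "\<delta> \<ge> 0" using d[of a] by (smt (verit) abs_ge_zero)
    have "pmf (softmax \<theta>' s) a * exp (- (2 * \<delta>)) = exp (\<theta>' s a) * exp (- \<delta>) / (exp \<delta> * ?Z \<theta>')"
      by (simp add: pmf_softmax exp_minus field_simps exp_add[symmetric] mult_exp_exp)
    also have "\<dots> \<le> exp (\<theta> s a) / ?Z \<theta>"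
      using Z e sum_exp_pos[of "\<theta> s"] by (intro frac_le) (auto simp: exp_minus field_simps)
    finally have *: "pmf (softmax \<theta>' s) a * exp (- (2 * \<delta>)) \<le> pmf (softmax \<theta> s) a"
      by (simp add: pmf_softmax)
    have "pmf (softmax \<theta>' s) a * (1 - 2 * \<delta>) \<le> pmf (softmax \<theta>' s) a * exp (- (2 * \<delta>))"
      using exp_ge_add_one_self[of "- (2 * \<delta>)"] by (intro mult_left_mono) auto
    moreover have "pmf (softmax \<theta>' s) a * (2 * \<delta>) \<le> 1 * (2 * \<delta>)"
      using d0 by (intro mult_right_mono pmf_le_1) auto
    ultimately show ?thesis using * by (simp add: algebra_simps)
  qed
  show ?thesis
    using ratio[of \<theta> \<theta>', OF assms] ratio[of \<theta>' \<theta>] assms by (simp add: abs_le_iff abs_minus_commute)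
qed

section \<open>Entropy-regularized dynamic programming\<close>

locale regularized_mdp = discounted_mdp M
  for M :: "('s::finite, 'a::finite) cmdp" +
  fixes \<tau> :: real
  assumes \<tau>_pos: "\<tau> > 0"
begin

text \<open>The entropy bonus becomes part of a policy-dependent reward, so regularized values are
  ordinary discounted returns and the identities above apply to them.\<close>

definition entropy_reward :: "('s, 'a) policy \<Rightarrow> ('s \<Rightarrow> 'a \<Rightarrow> real) \<Rightarrow> 's \<Rightarrow> 'a \<Rightarrow> real" where
  "entropy_reward \<pi> r s a = r s a + \<tau> * - ln (pmf (\<pi> s) a)"

text \<open>The log-sum-exp form of the soft Bellman optimality operator: by the Gibbs variational
  principle it is the maximum of expected Q-value plus \<tau> times entropy, attained at
  \<open>greedy\<close>.\<close>

definition soft_backup :: "('s \<Rightarrow> 'a \<Rightarrow> real) \<Rightarrow> ('s \<Rightarrow> real) \<Rightarrow> 's \<Rightarrow> real" where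
  "soft_backup r X s = \<tau> * ln (\<Sum>a\<in>UNIV. exp (action_value M r X s a / \<tau>))"

definition greedy :: "('s \<Rightarrow> 'a \<Rightarrow> real) \<Rightarrow> ('s \<Rightarrow> real) \<Rightarrow> ('s, 'a) policy" where
  "greedy r X = softmax (\<lambda>s a. action_value M r X s a / \<tau>)"

abbreviation eval_backup :: "('s \<Rightarrow> 'a \<Rightarrow> real) \<Rightarrow> ('s, 'a) policy \<Rightarrow> ('s \<Rightarrow> real) \<Rightarrow> 's \<Rightarrow> real" where
  "eval_backup r \<pi> X \<equiv> expect \<pi> (action_value M (entropy_reward \<pi> r) X)"

abbreviation reg_state_value :: "('s \<Rightarrow> 'a \<Rightarrow> real) \<Rightarrow> ('s, 'a) policy \<Rightarrow> 's \<Rightarrow> real" where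
  "reg_state_value r \<pi> \<equiv> state_value M \<pi> (entropy_reward \<pi> r)"

lemma reg_value_eq: "reg_value M \<tau> r \<pi> \<mu> = discounted_return M \<pi> \<mu> (entropy_reward \<pi> r)"
  unfolding reg_value_def entropy_val_def discounted_return_linear[symmetric] entropy_reward_def ..

lemma greedy_softmax [simp]: "greedy r X \<in> softmax_policies"
  by (simp add: greedy_def)

lemma ln_greedy:
  "\<tau> * ln (pmf (greedy r X s) a) = action_value M r X s a - soft_backup r X s"
  using \<tau>_pos sum_exp_pos[of "\<lambda>a. action_value M r X s a / \<tau>"]
  by (simp add: greedy_def pmf_softmax ln_div soft_backup_def algebra_simps)

text \<open>The Gibbs variational identity: by \<open>ln_greedy\<close>, Q-values are \<tau> times
  greedy log-probabilities up to a constant per state, so the deficit of \<open>\<pi>\<close> is a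
  relative entropy. Optimality needs only its sign, quadratic growth its size.\<close>

lemma soft_backup_gap:
  "soft_backup r X s - eval_backup r \<pi> X s =
    \<tau> * (\<Sum>a\<in>UNIV. pmf (\<pi> s) a * (ln (pmf (\<pi> s) a) - ln (pmf (greedy r X s) a)))"
proof -
  have "eval_backup r \<pi> X s = expect \<pi> (\<lambda>s a. soft_backup r X s -
      \<tau> * (ln (pmf (\<pi> s) a) - ln (pmf (greedy r X s) a))) s"
    unfolding expect_def
    by (intro sum.cong refl arg_cong2[where f="(*)"])
       (use ln_greedy[of r X s] in \<open>simp add: action_value_def entropy_reward_def algebra_simps\<close>)
  then show ?thesis
    by (simp add: expect_diff expect_cmult) (simp add: expect_def right_diff_distrib sum_subtractf)
qed

lemma eval_backup_greedy: "eval_backup r (greedy r X) X s = soft_backup r X s"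
  using soft_backup_gap[of r X s "greedy r X"] by simp

lemma eval_backup_le_soft_backup:
  assumes "\<pi> \<in> softmax_policies"
  shows "eval_backup r \<pi> X s \<le> soft_backup r X s"
proof -
  have "0 \<le> (\<Sum>a\<in>UNIV. (pmf (\<pi> s) a - pmf (greedy r X s) a)\<^sup>2) / 4"
    by (simp add: sum_nonneg)
  also have "\<dots> \<le> (\<Sum>a\<in>UNIV. pmf (\<pi> s) a * (ln (pmf (\<pi> s) a) - ln (pmf (greedy r X s) a)))"
    by (intro relative_entropy_ge pmf_softmax_policies_pos) (auto simp: assms)
  finally show ?thesis
    using soft_backup_gap[of r X s \<pi>] \<tau>_pos
    by (smt (verit) mult_nonneg_nonneg)
qed

lemma soft_backup_mono:
  assumes "\<And>s. X s \<le> Y s"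
  shows "soft_backup r X s \<le> soft_backup r Y s"
proof -
  have "(\<Sum>a\<in>UNIV. exp (action_value M r X s a / \<tau>)) \<le> (\<Sum>a\<in>UNIV. exp (action_value M r Y s a / \<tau>))"
    using \<tau>_pos by (intro sum_mono) (simp add: divide_right_mono action_value_mono assms)
  then show ?thesis
    unfolding soft_backup_def using \<tau>_pos by (intro mult_left_mono) (simp_all add: sum_exp_pos)
qed

lemma soft_backup_shift: "soft_backup r (\<lambda>s. X s + c) s = soft_backup r X s + \<gamma> * c"
proof -
  have "(\<Sum>a\<in>UNIV. exp (action_value M r (\<lambda>s. X s + c) s a / \<tau>)) =
      (\<Sum>a\<in>UNIV. exp (action_value M r X s a / \<tau>)) * exp (\<gamma> * c / \<tau>)"
    by (simp add: action_value_shift add_divide_distrib exp_add sum_distrib_right)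
  then show ?thesis
    using \<tau>_pos sum_exp_pos[of "\<lambda>a. action_value M r X s a / \<tau>"]
    by (simp add: soft_backup_def ln_mult distrib_left)
qed

text \<open>Monotonicity and the shift rule together are the one-sided form of sup-norm contraction
  by \<gamma>.\<close>

lemma soft_backup_le:
  assumes "\<And>s. X s \<le> Y s + c"
  shows "soft_backup r X s \<le> soft_backup r Y s + \<gamma> * c"
  using soft_backup_mono[of X "\<lambda>s. Y s + c"] assms by (simp add: soft_backup_shift)

text \<open>Value iteration from 0 has increments of order \<open>\<gamma> ^ n\<close>, so it
  converges at every state, and continuity of the finite log-sum-exp makes the limit a fixed
  point.\<close>

lemma soft_backup_fixpoint: "\<exists>V. \<forall>s. soft_backup r V s = V s"
proof -
  define x where "x n = (soft_backup r ^^ n) (\<lambda>_. 0)" for n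
  have x_Suc: "x (Suc n) = soft_backup r (x n)" for n by (simp add: x_def)
  obtain c where c: "\<And>s. \<bar>x 1 s - x 0 s\<bar> \<le> c"
    using finite_fun_bounded[of "\<lambda>s. x 1 s - x 0 s"] by metis
  have step: "\<bar>x (Suc n) s - x n s\<bar> \<le> \<gamma> ^ n * c" for n s
  proof (induction n arbitrary: s)
    case (Suc n)
    have "x (Suc n) s \<le> x n s + \<gamma> ^ n * c" "x n s \<le> x (Suc n) s + \<gamma> ^ n * c" for s
      using Suc[of s] by auto
    then have "x (Suc (Suc n)) s \<le> x (Suc n) s + \<gamma> * (\<gamma> ^ n * c)"
      "x (Suc n) s \<le> x (Suc (Suc n)) s + \<gamma> * (\<gamma> ^ n * c)"
      unfolding x_Suc[of "Suc n"] x_Suc[of n] by (intro soft_backup_le; simp add: x_Suc)+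
    then show ?case by auto
  qed (use c in simp)
  have "summable (\<lambda>n. \<gamma> ^ n * c)"
    by (intro summable_mult2 summable_geometric) simp
  then have "summable (\<lambda>n. x (Suc n) s - x n s)" for s
    by (rule summable_comparison_test') (use step in auto)
  then have "convergent (\<lambda>n. x n s)" for s
    using sum_lessThan_telescope[of "\<lambda>n. x n s" for s]
    by (simp add: summable_iff_convergent convergent_diff_const_right_iff)
  then obtain V where V: "\<And>s. (\<lambda>n. x n s) \<longlonglongrightarrow> V s"
    unfolding convergent_def by metis
  have "(\<lambda>n. soft_backup r (x n) s) \<longlonglongrightarrow> soft_backup r V s" for s
    unfolding soft_backup_def action_value_def integral_pmf_finite
    by (intro tendsto_intros V) (use \<tau>_pos sum_exp_pos in \<open>auto simp: less_imp_neq[OF sum_exp_pos, symmetric]\<close>)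
  then have "soft_backup r V s = V s" for s
    using LIMSEQ_Suc[OF V[of s]] unfolding x_Suc by (rule LIMSEQ_unique)
  then show ?thesis by blast
qed

text \<open>Some fixed point is chosen; \<open>reg_value_opt_policy\<close> and
  \<open>reg_value_le_opt\<close> then identify it as the optimal soft value.\<close>

definition opt_value :: "('s \<Rightarrow> 'a \<Rightarrow> real) \<Rightarrow> 's \<Rightarrow> real" where
  "opt_value r = (SOME V. \<forall>s. soft_backup r V s = V s)"

definition opt_policy :: "('s \<Rightarrow> 'a \<Rightarrow> real) \<Rightarrow> ('s, 'a) policy" where
  "opt_policy r = greedy r (opt_value r)"

lemma soft_backup_opt_value [simp]: "soft_backup r (opt_value r) s = opt_value r s"
  unfolding opt_value_def using someI_ex[OF soft_backup_fixpoint[of r]] by blast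

lemma opt_policy_softmax [simp]: "opt_policy r \<in> softmax_policies"
  by (simp add: opt_policy_def)

lemma reg_value_opt_policy:
  "reg_value M \<tau> r (opt_policy r) \<mu> = measure_pmf.expectation \<mu> (opt_value r)"
  using performance_difference[of \<mu> "opt_value r" "opt_policy r" "entropy_reward (opt_policy r) r"]
  by (simp add: reg_value_eq opt_policy_def eval_backup_greedy)

text \<open>A fixed point of the soft backup is a supersolution of the Bellman equation of every
  softmax policy.\<close>

lemma reg_value_le_opt:
  assumes "\<pi> \<in> softmax_policies"
  shows "reg_value M \<tau> r \<pi> \<mu> \<le> reg_value M \<tau> r (opt_policy r) \<mu>"
  unfolding reg_value_opt_policy unfolding reg_value_eq
  using eval_backup_le_soft_backup[OF assms, of r "opt_value r"]
  by (intro discounted_return_le) simp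

text \<open>For the continuation \<open>opt_value r\<close> the residual at a state is \<tau> times
  the relative entropy to the optimal policy. The factor 1/4 comes from
  \<open>relative_entropy_ge\<close>, \<open>d\<close> from the visitation bound, and 1 - \<gamma>
  from \<open>performance_difference\<close>.\<close>

lemma quadratic_growth:
  assumes \<pi>: "\<pi> \<in> softmax_policies" and d: "d \<ge> 0" "\<And>s. visitation M \<pi> \<mu> s \<ge> d"
  shows "\<tau> * d / (4 * (1 - \<gamma>)) * (norm (policy_vec \<pi> - policy_vec (opt_policy r)))\<^sup>2 \<le>
    reg_value M \<tau> r (opt_policy r) \<mu> - reg_value M \<tau> r \<pi> \<mu>"
proof -
  let ?D = "\<lambda>s. \<Sum>a\<in>UNIV. (pmf (\<pi> s) a - pmf (opt_policy r s) a)\<^sup>2"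
  have "(\<Sum>s\<in>UNIV. d * (\<tau> * (?D s / 4)))
      \<le> (\<Sum>s\<in>UNIV. visitation M \<pi> \<mu> s * (opt_value r s - eval_backup r \<pi> (opt_value r) s))"
  proof (intro sum_mono mult_mono d visitation_nonneg)
    fix s
    have "?D s / 4 \<le> (\<Sum>a\<in>UNIV. pmf (\<pi> s) a * (ln (pmf (\<pi> s) a) - ln (pmf (opt_policy r s) a)))"
      by (intro relative_entropy_ge pmf_softmax_policies_pos) (auto simp: \<pi>)
    then have "\<tau> * (?D s / 4) \<le> soft_backup r (opt_value r) s - eval_backup r \<pi> (opt_value r) s"
      unfolding soft_backup_gap opt_policy_def using \<tau>_pos by (intro mult_left_mono) auto
    then show "\<tau> * (?D s / 4) \<le> opt_value r s - eval_backup r \<pi> (opt_value r) s" by simp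
    show "0 \<le> \<tau> * (?D s / 4)" using \<tau>_pos by (simp add: sum_nonneg)
  qed
  then have "(\<Sum>s\<in>UNIV. d * (\<tau> * (?D s / 4))) / (1 - \<gamma>) \<le>
      reg_value M \<tau> r (opt_policy r) \<mu> - reg_value M \<tau> r \<pi> \<mu>"
    unfolding reg_value_opt_policy unfolding reg_value_eq performance_difference by (intro divide_right_mono) auto
  then show ?thesis
    unfolding norm_policy_vec_sq
    by (simp add: sum_distrib_left[symmetric] sum_divide_distrib[symmetric] mult_ac)
qed

subsection \<open>Soft policy iteration\<close>

text \<open>The geometric series of the largest reward per step, \<open>R\<close>, plus the largest
  entropy bonus, that of the uniform distribution.\<close>

definition value_bound :: "real \<Rightarrow> real" where
  "value_bound R = (R + \<tau> * ln (real CARD('a))) / (1 - \<gamma>)"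

text \<open>The constant function \<open>value_bound R\<close> is a supersolution of the soft
  Bellman equation, so the comparison principle applies to it.\<close>

lemma opt_value_bound:
  assumes r: "\<And>s a. r s a \<le> R"
  shows "opt_value r s \<le> value_bound R"
proof -
  let ?K = "value_bound R"
  have K: "R + \<gamma> * ?K + \<tau> * ln (real CARD('a)) = ?K"
    by (simp add: value_bound_def field_simps)
  have "soft_backup r (\<lambda>_. ?K) s \<le> ?K" for s
  proof -
    have "(\<Sum>a\<in>UNIV. exp (action_value M r (\<lambda>_. ?K) s a / \<tau>)) \<le> (\<Sum>a\<in>(UNIV :: 'a set). exp ((R + \<gamma> * ?K) / \<tau>))"
      using \<tau>_pos r by (intro sum_mono) (simp add: action_value_def divide_right_mono)
    then have "soft_backup r (\<lambda>_. ?K) s \<le> \<tau> * ln (real CARD('a) * exp ((R + \<gamma> * ?K) / \<tau>))"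
      unfolding soft_backup_def using \<tau>_pos sum_exp_pos[of "\<lambda>a. action_value M r (\<lambda>_. ?K) s a / \<tau>"]
      by (intro mult_left_mono) (auto simp: ln_le_cancel_iff)
    also have "\<dots> = ?K"
      using \<tau>_pos K by (simp add: ln_mult distrib_left[of \<tau> "ln (real CARD('a))"])
    finally show ?thesis .
  qed
  then have "reg_value M \<tau> r (opt_policy r) (return_pmf s) \<le> measure_pmf.expectation (return_pmf s) (\<lambda>_. ?K)"
    unfolding reg_value_eq
    using eval_backup_le_soft_backup[of "opt_policy r" r "\<lambda>_. ?K"]
    by (intro discounted_return_le) (auto intro: order.trans)
  then show ?thesis by (simp add: reg_value_opt_policy)
qed

lemma reg_state_value_nonneg:
  assumes r: "\<And>s a. r s a \<ge> 0"
  shows "0 \<le> reg_state_value r \<pi> s"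
proof -
  have nn: "0 \<le> entropy_reward \<pi> r s a" for s a
  proof -
    \<comment> \<open>A zero probability has to be treated separately; there the value of
      \<open>ln 0\<close> is 0.\<close>
    have "ln (pmf (\<pi> s) a) \<le> 0"
      using pmf_le_1[of "\<pi> s" a] pmf_nonneg[of "\<pi> s" a] by (cases "pmf (\<pi> s) a = 0") auto
    then have "\<tau> * ln (pmf (\<pi> s) a) \<le> 0"
      using \<tau>_pos by (simp add: mult_le_0_iff)
    then show ?thesis using r[of s a] by (simp add: entropy_reward_def)
  qed
  have "expect \<pi> (\<lambda>s a. 0) s \<le> eval_backup r \<pi> (\<lambda>_. 0) s" for s
    using nn by (intro expect_le) (simp add: action_value_def)
  then have "measure_pmf.expectation (return_pmf s) (\<lambda>_. 0) \<le> reg_state_value r \<pi> s"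
    unfolding state_value_def by (intro discounted_return_ge) simp
  then show ?thesis by simp
qed

lemma reg_state_value_le_opt_value:
  assumes "\<pi> \<in> softmax_policies"
  shows "reg_state_value r \<pi> s \<le> opt_value r s"
  using reg_value_le_opt[OF assms, of r "return_pmf s"] unfolding reg_value_opt_policy
  by (simp add: reg_value_eq state_value_def)

text \<open>Policy improvement: the current value is a subsolution of the Bellman equation of the
  greedy policy, hence below its value. Inserting this inequality once into that Bellman equation
  strengthens the lower bound to the soft backup.\<close>

lemma soft_backup_le_greedy_value:
  assumes "\<pi> \<in> softmax_policies"
  shows "soft_backup r (reg_state_value r \<pi>) s \<le> reg_state_value r (greedy r (reg_state_value r \<pi>)) s"
proof -
  let ?V = "reg_state_value r \<pi>" and ?\<pi> = "greedy r (reg_state_value r \<pi>)"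
  have "?V s \<le> eval_backup r ?\<pi> ?V s" for s
    unfolding eval_backup_greedy
    using eval_backup_le_soft_backup[OF assms, of r ?V s] by (simp add: state_value_bellman[symmetric])
  then have "measure_pmf.expectation (return_pmf s) ?V \<le> reg_state_value r ?\<pi> s" for s
    unfolding state_value_def[of _ ?\<pi>] by (rule discounted_return_ge)
  then have "?V s \<le> reg_state_value r ?\<pi> s" for s by simp
  then have "eval_backup r ?\<pi> ?V s \<le> eval_backup r ?\<pi> (reg_state_value r ?\<pi>) s"
    by (intro expect_le action_value_mono)
  then show ?thesis
    by (simp add: eval_backup_greedy state_value_bellman[symmetric])
qed

text \<open>A policy improvement step gains at least as much as a step of value iteration, and the
  latter contracts by \<gamma>.\<close>

lemma greedy_contraction:
  assumes \<pi>: "\<pi> \<in> softmax_policies" and c: "\<And>s. opt_value r s - reg_state_value r \<pi> s \<le> c"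
  shows "opt_value r s - reg_state_value r (greedy r (reg_state_value r \<pi>)) s \<le> \<gamma> * c"
proof -
  have "soft_backup r (opt_value r) s \<le> soft_backup r (reg_state_value r \<pi>) s + \<gamma> * c"
    using c by (intro soft_backup_le) (simp add: algebra_simps)
  then show ?thesis
    using soft_backup_le_greedy_value[OF \<pi>, of r s] by simp
qed

text \<open>Both policies are softmaxes of Q/\<tau>, so comparing logits gives a policy error linear
  in the value gap; quadratic growth would give only a square root.\<close>

lemma greedy_close:
  assumes \<pi>: "\<pi> \<in> softmax_policies" and c: "\<And>s. opt_value r s - reg_state_value r \<pi> s \<le> c"
  shows "\<bar>pmf (greedy r (reg_state_value r \<pi>) s) a - pmf (opt_policy r s) a\<bar> \<le> 2 * (\<gamma> * c / \<tau>)"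
  unfolding opt_policy_def greedy_def
proof (rule softmax_close)
  fix a
  have "action_value M r (reg_state_value r \<pi>) s a \<le> action_value M r (opt_value r) s a"
    by (intro action_value_mono reg_state_value_le_opt_value \<pi>)
  moreover have "action_value M r (opt_value r) s a \<le> action_value M r (reg_state_value r \<pi>) s a + \<gamma> * c"
    unfolding action_value_shift[symmetric] using c by (intro action_value_mono) (simp add: algebra_simps)
  ultimately show "\<bar>action_value M r (reg_state_value r \<pi>) s a / \<tau> - action_value M r (opt_value r) s a / \<tau>\<bar>
      \<le> \<gamma> * c / \<tau>"
    using \<tau>_pos by (simp add: diff_divide_distrib[symmetric] abs_div_pos divide_right_mono)
qed

text \<open>The exponent \<open>1 - \<eta> \<tau> / (1 - \<gamma>)\<close> of the current policy vanishes.\<close>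

lemma npg_step_eq_greedy:
  assumes "\<pi> \<in> softmax_policies"
  shows "npg_step M \<tau> ((1 - discount M) / \<tau>) l \<pi> =
    greedy (reward_lam M l) (reg_state_value (reward_lam M l) \<pi>)"
proof
  fix s
  have "pmf (\<pi> s) a powr (1 - (1 - \<gamma>) / \<tau> * \<tau> / (1 - \<gamma>)) = 1" for a
    using pmf_softmax_policies_pos[OF assms, of s a] \<tau>_pos by simp
  moreover have "(1 - \<gamma>) / \<tau> * q / (1 - \<gamma>) = q / \<tau>" for q
    by simp
  moreover have "Q_lam M \<tau> l \<pi> s a = action_value M (reward_lam M l) (reg_state_value (reward_lam M l) \<pi>) s a" for a
    by (simp add: Q_lam_def action_value_def reg_value_eq state_value_def[abs_def])
  ultimately show "npg_step M \<tau> ((1 - discount M) / \<tau>) l \<pi> s =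
      greedy (reward_lam M l) (reg_state_value (reward_lam M l) \<pi>) s"
    by (simp add: npg_step_def greedy_def softmax_def del: times_divide_eq_left)
qed

section \<open>Geometric convergence of the NPG iterates\<close>

abbreviation npg :: "real \<Rightarrow> ('s, 'a) policy \<Rightarrow> nat \<Rightarrow> ('s, 'a) policy" where
  "npg \<equiv> npg_sub M \<tau> ((1 - discount M) / \<tau>)"

lemma npg_0 [simp]: "npg l \<pi> 0 = \<pi>"
  by (simp add: npg_sub_def)

lemma npg_Suc: "npg l \<pi> (Suc n) = npg_step M \<tau> ((1 - discount M) / \<tau>) l (npg l \<pi> n)"
  by (simp add: npg_sub_def)

lemma npg_softmax:
  assumes "\<pi> \<in> softmax_policies"
  shows "npg l \<pi> n \<in> softmax_policies"
  by (induction n) (simp_all add: assms npg_Suc npg_step_eq_greedy)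

lemma npg_value_gap:
  assumes \<pi>: "\<pi> \<in> softmax_policies" and r: "\<And>s a. reward_lam M l s a \<in> {0..R}"
  shows "opt_value (reward_lam M l) s - reg_state_value (reward_lam M l) (npg l \<pi> n) s
    \<le> \<gamma> ^ n * value_bound R"
proof (induction n arbitrary: s)
  case 0
  have "opt_value (reward_lam M l) s \<le> value_bound R" "0 \<le> reg_state_value (reward_lam M l) \<pi> s"
    using r by (auto intro: opt_value_bound reg_state_value_nonneg)
  then show ?case by simp
next
  case (Suc n)
  show ?case
    using greedy_contraction[OF npg_softmax[OF \<pi>] Suc]
    by (simp add: npg_Suc npg_step_eq_greedy[OF npg_softmax[OF \<pi>]] mult.assoc)
qed

text \<open>At \<open>n = 0\<close> the policy is arbitrary and only the trivial bound 1 is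
  available, whence the \<open>max\<close>. Later, the value gap after \<open>n - 1\<close> steps
  and the factor \<gamma> in \<open>greedy_close\<close> combine to
  \<open>\<gamma> ^ n\<close>.\<close>

lemma npg_policy_gap:
  assumes \<pi>: "\<pi> \<in> softmax_policies" and r: "\<And>s a. reward_lam M l s a \<in> {0..R}"
  shows "\<bar>pmf (npg l \<pi> n s) a - pmf (opt_policy (reward_lam M l) s) a\<bar>
    \<le> max 1 (2 * value_bound R / \<tau>) * \<gamma> ^ n"
proof (cases n)
  case 0
  have "\<bar>pmf (\<pi> s) a - pmf (opt_policy (reward_lam M l) s) a\<bar> \<le> 1"
    using pmf_le_1[of "\<pi> s" a] pmf_le_1[of "opt_policy (reward_lam M l) s" a]
      pmf_nonneg[of "\<pi> s" a] pmf_nonneg[of "opt_policy (reward_lam M l) s" a] by linarith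
  then show ?thesis using 0 by simp
next
  case (Suc m)
  have "\<bar>pmf (npg l \<pi> n s) a - pmf (opt_policy (reward_lam M l) s) a\<bar>
      \<le> 2 * (\<gamma> * (\<gamma> ^ m * value_bound R) / \<tau>)"
    unfolding Suc npg_Suc npg_step_eq_greedy[OF npg_softmax[OF \<pi>]]
    by (rule greedy_close[OF npg_softmax[OF \<pi>] npg_value_gap[OF \<pi> r]])
  also have "\<dots> = (2 * value_bound R / \<tau>) * \<gamma> ^ n"
    by (simp add: Suc)
  also have "\<dots> \<le> max 1 (2 * value_bound R / \<tau>) * \<gamma> ^ n"
    by (intro mult_right_mono) auto
  finally show ?thesis .
qed

lemma npg_policy_vec_gap:
  assumes \<pi>: "\<pi> \<in> softmax_policies" and r: "\<And>s a. reward_lam M l s a \<in> {0..R}"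
  shows "norm (policy_vec (npg l \<pi> n) - policy_vec (opt_policy (reward_lam M l)))
    \<le> real (CARD('s) * CARD('a)) * max 1 (2 * value_bound R / \<tau>) * \<gamma> ^ n"
proof -
  let ?v = "policy_vec (npg l \<pi> n) - policy_vec (opt_policy (reward_lam M l))"
  have "norm ?v \<le> (\<Sum>i\<in>UNIV. \<bar>?v $ i\<bar>)" by (rule norm_le_l1_cart)
  also have "\<dots> \<le> (\<Sum>i\<in>(UNIV :: ('s \<times> 'a) set). max 1 (2 * value_bound R / \<tau>) * \<gamma> ^ n)"
    using npg_policy_gap[OF \<pi> r] by (intro sum_mono) (simp add: policy_vec_def)
  finally show ?thesis by simp
qed

lemma npg_reg_value_gap:
  assumes \<pi>: "\<pi> \<in> softmax_policies" and r: "\<And>s a. reward_lam M l s a \<in> {0..R}"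
  shows "reg_value M \<tau> (reward_lam M l) (opt_policy (reward_lam M l)) \<mu> -
      reg_value M \<tau> (reward_lam M l) (npg l \<pi> n) \<mu> \<le> \<gamma> ^ n * value_bound R"
proof -
  have "reg_value M \<tau> (reward_lam M l) (opt_policy (reward_lam M l)) \<mu> -
      reg_value M \<tau> (reward_lam M l) (npg l \<pi> n) \<mu> = measure_pmf.expectation \<mu>
        (\<lambda>s. opt_value (reward_lam M l) s - reg_state_value (reward_lam M l) (npg l \<pi> n) s)"
    by (simp add: reg_value_opt_policy reg_value_eq[of _ "npg l \<pi> n"] discounted_return_init
      integral_pmf_diff_finite)
  also have "\<dots> \<le> measure_pmf.expectation \<mu> (\<lambda>_. \<gamma> ^ n * value_bound R)"
    by (intro integral_pmf_mono_finite npg_value_gap \<pi> r)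
  finally show ?thesis by simp
qed

end

subsection \<open>The dual function\<close>

locale exploring_cmdp = regularized_mdp M \<tau>
  for M :: "('s::finite, 'a::finite) cmdp" and \<tau> :: real +
  fixes d :: real
  assumes reward_bounds: "reward M s a \<in> {0..1}"
    and utility_bounds: "utility M s a \<in> {0..1}"
    and d_pos: "d > 0"
    and visitation_ge: "\<pi> \<in> softmax_policies \<Longrightarrow> visitation M \<pi> (init M) s \<ge> d"
begin

definition dual_policy :: "real \<Rightarrow> ('s, 'a) policy" where
  "dual_policy l = opt_policy (reward_lam M l)"

text \<open>The envelope-theorem candidate for the derivative of the dual;
  \<open>dual_has_derivative\<close> confirms it.\<close>

definition dual_grad :: "real \<Rightarrow> real" where
  "dual_grad l = U_val M (dual_policy l) - threshold M"

definition growth_const :: real where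
  "growth_const = \<tau> * d / (4 * (1 - \<gamma>))"

definition U_lip :: real where
  "U_lip = sqrt (real CARD('a)) / (1 - \<gamma>)\<^sup>2"

text \<open>The inner quotient is the Lipschitz constant of the maximizer as a function of the
  multiplier, the outer factor that of the utility.\<close>

definition grad_lip :: real where
  "grad_lip = U_lip * (U_lip / (2 * growth_const))"

lemma growth_const_pos: "growth_const > 0"
  unfolding growth_const_def using \<tau>_pos d_pos by (intro divide_pos_pos mult_pos_pos) auto

lemma U_lip_pos: "U_lip > 0"
  by (simp add: U_lip_def)

lemma grad_lip_pos: "grad_lip > 0"
  using growth_const_pos U_lip_pos by (simp add: grad_lip_def)

lemma dual_policy_softmax [simp]: "dual_policy l \<in> softmax_policies"
  by (simp add: dual_policy_def)

text \<open>For a fixed multiplier, maximizing the Lagrangian is an unconstrained regularized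
  problem, to which the soft Bellman theory applies.\<close>

lemma lagrangian_eq_reg_value:
  "lagrangian M \<tau> \<pi> l = reg_value M \<tau> (reward_lam M l) \<pi> (init M) - l * threshold M"
proof -
  have "reward_lam M l = (\<lambda>s a. reward M s a + l * utility M s a)"
    by (intro ext) (simp add: reward_lam_def)
  then show ?thesis
    by (simp add: lagrangian_def V_reg_def reg_value_def U_val_def discounted_return_linear algebra_simps)
qed

lemma lagrangian_le:
  assumes "\<pi> \<in> softmax_policies"
  shows "lagrangian M \<tau> \<pi> l \<le> lagrangian M \<tau> (dual_policy l) l"
  using reg_value_le_opt[OF assms] by (simp add: lagrangian_eq_reg_value dual_policy_def)

lemma dual_eq: "dual M \<tau> l = lagrangian M \<tau> (dual_policy l) l"
  unfolding dual_def by (rule cSup_eq_maximum) (auto intro: lagrangian_le)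

lemma lagrangian_shift:
  "lagrangian M \<tau> \<pi> l' = lagrangian M \<tau> \<pi> l + (l' - l) * (U_val M \<pi> - threshold M)"
  by (simp add: lagrangian_def algebra_simps)

lemma lagrangian_le_dual:
  assumes "\<pi> \<in> softmax_policies"
  shows "lagrangian M \<tau> \<pi> l \<le> dual M \<tau> l"
  using lagrangian_le[OF assms] by (simp add: dual_eq)

lemma lagrangian_dual_policy: "lagrangian M \<tau> (dual_policy l) l' = dual M \<tau> l + (l' - l) * dual_grad l"
  using lagrangian_shift[of "dual_policy l" l' l] by (simp add: dual_eq dual_grad_def)

text \<open>The maximizer at \<open>l\<close> competes at \<open>l'\<close>, and its Lagrangian is
  affine in the multiplier. Convexity of the dual enters the proof in this form.\<close>

lemma dual_subgradient: "dual M \<tau> l + (l' - l) * dual_grad l \<le> dual M \<tau> l'"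
  using lagrangian_le_dual[of "dual_policy l" l'] by (simp add: lagrangian_dual_policy)

lemma dual_gap_ge_dist:
  assumes "\<pi> \<in> softmax_policies"
  shows "growth_const * (norm (policy_vec \<pi> - policy_vec (dual_policy l)))\<^sup>2 \<le> dual M \<tau> l - lagrangian M \<tau> \<pi> l"
  using quadratic_growth[OF assms _ visitation_ge[OF assms], of "reward_lam M l"] d_pos
  by (simp add: dual_eq lagrangian_eq_reg_value dual_policy_def growth_const_def)

lemma U_val_lipschitz:
  "\<bar>U_val M \<pi> - U_val M \<pi>'\<bar> \<le> U_lip * norm (policy_vec \<pi> - policy_vec \<pi>')"
  unfolding U_val_def U_lip_def
  using discounted_return_lipschitz[of "utility M" \<pi> "init M" \<pi>'] utility_bounds by (simp add: norm_minus_commute)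

text \<open>Adding the growth inequalities of \<open>l\<close> and \<open>l'\<close> bounds the squared distance of the maximizers by
  \<open>(l - l') * (dual_grad l - dual_grad l')\<close>, which is at most linear in that distance.\<close>

lemma dual_grad_lipschitz: "\<bar>dual_grad l - dual_grad l'\<bar> \<le> grad_lip * \<bar>l - l'\<bar>"
proof -
  let ?n = "norm (policy_vec (dual_policy l) - policy_vec (dual_policy l'))"
  have "growth_const * ?n\<^sup>2 \<le> dual M \<tau> l' - lagrangian M \<tau> (dual_policy l) l'"
    by (rule dual_gap_ge_dist) simp
  moreover have "growth_const * ?n\<^sup>2 \<le> dual M \<tau> l - lagrangian M \<tau> (dual_policy l') l"
    using dual_gap_ge_dist[of "dual_policy l'" l] by (simp add: norm_minus_commute)
  ultimately have "2 * (growth_const * ?n\<^sup>2) \<le> (l - l') * (dual_grad l - dual_grad l')"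
    unfolding lagrangian_dual_policy by (simp add: algebra_simps)
  also have "\<dots> \<le> \<bar>l - l'\<bar> * \<bar>dual_grad l - dual_grad l'\<bar>"
    unfolding abs_mult[symmetric] by simp
  also have "\<dots> \<le> \<bar>l - l'\<bar> * (U_lip * ?n)"
    using U_val_lipschitz[of "dual_policy l" "dual_policy l'"] by (intro mult_left_mono) (simp_all add: dual_grad_def)
  finally have "?n * (2 * growth_const * ?n) \<le> ?n * (U_lip * \<bar>l - l'\<bar>)"
    by (simp add: power2_eq_square algebra_simps)
  then have "2 * growth_const * ?n \<le> U_lip * \<bar>l - l'\<bar>"
    using U_lip_pos by (cases "?n = 0") simp_all
  then have "?n \<le> U_lip / (2 * growth_const) * \<bar>l - l'\<bar>"
    using growth_const_pos by (simp add: field_simps)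
  then have "U_lip * ?n \<le> U_lip * (U_lip / (2 * growth_const) * \<bar>l - l'\<bar>)"
    using U_lip_pos by (intro mult_left_mono) auto
  then show ?thesis
    using U_val_lipschitz[of "dual_policy l" "dual_policy l'"]
    unfolding dual_grad_def grad_lip_def mult.assoc by linarith
qed

text \<open>The subgradient inequalities at both ends squeeze the linearization error between 0 and
  \<open>(x - l) * (dual_grad x - dual_grad l)\<close>, which is quadratic in \<open>x - l\<close>
  by the Lipschitz bound.\<close>

lemma dual_has_derivative: "(dual M \<tau> has_real_derivative dual_grad l) (at l)"
  unfolding has_field_derivative_iff
proof (rule LIM_I)
  fix e :: real
  assume e: "e > 0"
  have "norm ((dual M \<tau> x - dual M \<tau> l) / (x - l) - dual_grad l) < e"
    if x: "x \<noteq> l" "norm (x - l) < e / grad_lip" for x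
  proof -
    let ?E = "dual M \<tau> x - dual M \<tau> l - (x - l) * dual_grad l"
    have "0 \<le> ?E" "?E \<le> (x - l) * (dual_grad x - dual_grad l)"
      using dual_subgradient[of l x] dual_subgradient[of x l] by (simp_all add: algebra_simps)
    then have "\<bar>?E\<bar> \<le> \<bar>x - l\<bar> * \<bar>dual_grad x - dual_grad l\<bar>"
      unfolding abs_mult[symmetric] by linarith
    also have "\<dots> \<le> \<bar>x - l\<bar> * (grad_lip * \<bar>x - l\<bar>)"
      by (intro mult_left_mono dual_grad_lipschitz) simp
    finally have "\<bar>?E / (x - l)\<bar> \<le> grad_lip * \<bar>x - l\<bar>"
      using x by (simp add: abs_divide field_simps)
    also have "\<dots> < e"
      using x grad_lip_pos by (simp add: field_simps)
    finally show ?thesis using x by (simp add: diff_divide_distrib)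
  qed
  then show "\<exists>s>0. \<forall>x. x \<noteq> l \<and> norm (x - l) < s \<longrightarrow>
      norm ((dual M \<tau> x - dual M \<tau> l) / (x - l) - dual_grad l) < e"
    using e grad_lip_pos by (intro exI[of _ "e / grad_lip"]) auto
qed

lemma deriv_dual: "deriv (dual M \<tau>) l = dual_grad l"
  by (rule DERIV_imp_deriv[OF dual_has_derivative])

text \<open>One reward bound for the whole interval makes the NPG rates uniform over all multipliers
  that bisection can visit.\<close>

lemma reward_lam_bounds:
  assumes "l \<in> {0..B}"
  shows "reward_lam M l s a \<in> {0..1 + B}"
proof -
  have "0 \<le> l * utility M s a" "l * utility M s a \<le> B * 1"
    using assms utility_bounds[of s a] by (simp, intro mult_mono) auto
  then show ?thesis using reward_bounds[of s a] by (simp add: reward_lam_def)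
qed

lemma npg_dual_policy_gap:
  assumes "\<pi> \<in> softmax_policies" "l \<in> {0..B}"
  shows "norm (policy_vec (npg l \<pi> n) - policy_vec (dual_policy l))
    \<le> real (CARD('s) * CARD('a)) * max 1 (2 * value_bound (1 + B) / \<tau>) * \<gamma> ^ n"
  unfolding dual_policy_def by (rule npg_policy_vec_gap[OF assms(1) reward_lam_bounds[OF assms(2)]])

lemma npg_lagrangian_gap:
  assumes "\<pi> \<in> softmax_policies" "l \<in> {0..B}"
  shows "dual M \<tau> l - lagrangian M \<tau> (npg l \<pi> n) l \<le> \<gamma> ^ n * value_bound (1 + B)"
  using npg_reg_value_gap[OF assms(1) reward_lam_bounds[OF assms(2)], of "init M" n]
  by (simp add: dual_eq lagrangian_eq_reg_value dual_policy_def)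

end

subsection \<open>Bisection with an inexact gradient\<close>

text \<open>Without a break, an oracle accurate to \<open>\<epsilon> / 2\<close> reveals the sign of
  \<open>G\<close> at the midpoint, so each halved bracket keeps its sign change. After
  \<open>n\<close> halvings one further pass must break, hence \<open>Suc n\<close>.\<close>

lemma bisection_loop_terminates:
  fixes G h :: "real \<Rightarrow> real"
  assumes lip: "\<And>x y. \<bar>G x - G y\<bar> \<le> K * \<bar>x - y\<bar>"
    and h: "\<And>x. x \<in> {a..b} \<Longrightarrow> \<bar>h x - G x\<bar> \<le> \<epsilon> / 2"
    and \<epsilon>: "\<epsilon> > 0"
    and bracket: "a \<le> p" "p \<le> q" "q \<le> b" "G p \<le> 0" "0 \<le> G q"
    and width: "K * (q - p) \<le> 2 ^ n * (\<epsilon> / 2)"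
  shows "\<exists>k l. bisection_loop h \<epsilon> p q k l \<and> k \<le> Suc n \<and> l \<in> {p..q} \<and> \<bar>h l\<bar> < \<epsilon>"
  using bracket width
proof (induction n arbitrary: p q)
  case 0
  let ?m = "(p + q) / 2"
  \<comment> \<open>The sign change and the Lipschitz bound put \<open>G\<close> at the midpoint
    within \<open>\<epsilon> / 4\<close> of zero; the oracle error raises this to at most 3/4 of the
    threshold.\<close>
  have "\<bar>G ?m - G p\<bar> \<le> K * ((q - p) / 2)" "\<bar>G q - G ?m\<bar> \<le> K * ((q - p) / 2)"
    using lip[of ?m p] lip[of q ?m] \<open>p \<le> q\<close> by (simp_all add: field_simps)
  moreover have quarter: "K * ((q - p) / 2) \<le> \<epsilon> / 4"
    using 0 by simp
  moreover have "\<bar>h ?m - G ?m\<bar> \<le> \<epsilon> / 2"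
    using 0 by (intro h) auto
  ultimately have "\<bar>h ?m\<bar> < \<epsilon>"
    using 0 \<epsilon> quarter by linarith
  then have "bisection_loop h \<epsilon> p q 1 ?m"
    by (rule bisection_loop.break)
  then show ?case
    using \<open>\<bar>h ?m\<bar> < \<epsilon>\<close> 0 by (intro exI[of _ 1] exI[of _ ?m]) auto
next
  case (Suc n)
  let ?m = "(p + q) / 2"
  have m: "a \<le> ?m" "?m \<le> b" "p \<le> ?m" "?m \<le> q" using Suc.prems by auto
  have hm: "\<bar>h ?m - G ?m\<bar> \<le> \<epsilon> / 2" using m by (intro h) auto
  have w: "K * (?m - p) \<le> 2 ^ n * (\<epsilon> / 2)" "K * (q - ?m) \<le> 2 ^ n * (\<epsilon> / 2)"
    using Suc.prems by (simp_all add: field_simps)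
  consider "\<bar>h ?m\<bar> < \<epsilon>" | "\<not> \<bar>h ?m\<bar> < \<epsilon>" "h ?m \<ge> \<epsilon>" | "\<not> \<bar>h ?m\<bar> < \<epsilon>" "\<not> h ?m \<ge> \<epsilon>" by blast
  then show ?case
  proof cases
    case 1
    then have "bisection_loop h \<epsilon> p q 1 ?m"
      by (rule bisection_loop.break)
    then show ?thesis using 1 m by (intro exI[of _ 1] exI[of _ ?m]) auto
  next
    case 2
    have "0 \<le> G ?m" using 2 hm \<epsilon> by linarith
    then obtain k l where "bisection_loop h \<epsilon> p ?m k l" "k \<le> Suc n" "l \<in> {p..?m}" "\<bar>h l\<bar> < \<epsilon>"
      using Suc.IH[of p ?m] Suc.prems m w by blast
    then show ?thesis
      using bisection_loop.left[where h=h and \<epsilon>=\<epsilon> and p=p and q=q, OF 2] m by (intro exI[of _ "Suc k"] exI[of _ l]) auto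
  next
    case 3
    have "G ?m \<le> 0" using 3 hm \<epsilon> by linarith
    then obtain k l where "bisection_loop h \<epsilon> ?m q k l" "k \<le> Suc n" "l \<in> {?m..q}" "\<bar>h l\<bar> < \<epsilon>"
      using Suc.IH[of ?m q] Suc.prems m w by blast
    then show ?thesis
      using bisection_loop.right[where h=h and \<epsilon>=\<epsilon> and p=p and q=q, OF 3] m by (intro exI[of _ "Suc k"] exI[of _ l]) auto
  qed
qed

text \<open>Solving for the exponent gives an iteration number for any geometric rate. It supplies
  the number of halvings and both NPG lengths.\<close>

lemma log_many_steps:
  fixes \<beta> C :: real
  assumes \<beta>: "0 < \<beta>" "\<beta> < 1"
  shows "\<exists>N :: real \<Rightarrow> nat. (\<forall>x>0. C * \<beta> ^ N x \<le> x) \<and>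
    (\<lambda>x. real (Suc (N x))) \<in> O[at_right 0](\<lambda>x. ln (1 / x))"
proof -
  \<comment> \<open>Raising \<open>C\<close> to at least 1 makes \<open>ln D\<close>
    nonnegative.\<close>
  define D L where "D = max 1 C" and "L = - ln \<beta>"
  have D: "D \<ge> 1" "C \<le> D" and L: "L > 0"
    using \<beta> by (auto simp: D_def L_def)
  define N where "N x = nat \<lceil>ln (D / x) / L\<rceil>" for x
  have "C * \<beta> ^ N x \<le> x" if x: "x > 0" for x
  proof -
    have "ln (D / x) / L \<le> real (N x)" by (simp add: N_def of_nat_ceiling)
    then have "ln (D / x) \<le> real (N x) * L" using L by (simp add: field_simps)
    then have "exp (- (real (N x) * L)) \<le> exp (- ln (D / x))" by simp
    also have "exp (- ln (D / x)) = x / D" using x D by (simp add: exp_minus field_simps)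
    also have "exp (- (real (N x) * L)) = \<beta> ^ N x"
      using \<beta> by (simp add: L_def exp_of_nat_mult)
    finally have "D * \<beta> ^ N x \<le> x" using D by (simp add: field_simps)
    moreover have "C * \<beta> ^ N x \<le> D * \<beta> ^ N x" using D \<beta> by (intro mult_right_mono) auto
    ultimately show ?thesis by linarith
  qed
  moreover have "(\<lambda>x. real (Suc (N x))) \<in> O[at_right 0](\<lambda>x. ln (1 / x))"
  proof (rule bigoI)
    \<comment> \<open>Below \<open>exp (- 1)\<close> the logarithm of \<open>1 / x\<close> is at
      least 1 and absorbs the additive constants; the 2 pays for the ceiling and the
      \<open>Suc\<close>.\<close>
    have "\<forall>\<^sub>F x in at_right 0. x \<in> {0<..<exp (- 1 :: real)}"
      by (rule eventually_at_right_real) simp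
    then show "\<forall>\<^sub>F x in at_right 0. norm (real (Suc (N x))) \<le> (2 + (ln D + 1) / L) * norm (ln (1 / x))"
    proof eventually_elim
      case (elim x)
      have l1: "ln (1 / x) \<ge> 1"
        using elim ln_le_cancel_iff[of x "exp (- 1)"] by (simp add: ln_div)
      have ln_eq: "ln (D / x) = ln D + ln (1 / x)" using elim D by (simp add: ln_div)
      also have "\<dots> \<le> ln D * ln (1 / x) + ln (1 / x)"
        using l1 D mult_left_mono[of 1 "ln (1 / x)" "ln D"] by simp
      finally have "ln (D / x) / L \<le> (ln D + 1) / L * ln (1 / x)"
        using L by (simp add: field_simps)
      moreover have "0 \<le> ln (D / x)"
        using ln_eq D l1 by simp
      then have "real (N x) \<le> ln (D / x) / L + 1"
        unfolding N_def using L of_int_ceiling_le_add_one[of "ln (D / x) / L"] by simp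
      ultimately show ?case using l1 by (simp add: algebra_simps)
    qed
  qed
  ultimately show ?thesis by blast
qed

section \<open>Dual gap of the bisection output and recovery of the primal solution\<close>

context exploring_cmdp
begin

text \<open>At a break the true gradient is at most 3/2 of the threshold, and the subgradient
  inequality multiplies it by a distance of at most \<open>B\<close>. At a skipped loop the sign of
  the gradient makes the endpoint optimal on the whole interval.\<close>

lemma bisection_dual_gap:
  fixes N1 :: nat
  assumes \<epsilon>: "\<epsilon> > 0" and l_star: "l_star \<in> {0..B}"
    and inexact: "\<And>l. l \<in> {0..B} \<Longrightarrow> \<bar>grad_sub M \<tau> ((1 - discount M) / \<tau>) l \<pi>0 N1 - dual_grad l\<bar> \<le> \<epsilon> / 2"
    and width: "grad_lip * B \<le> 2 ^ J * (\<epsilon> / 2)"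
  shows "\<exists>\<pi> l n. bisection_npg M \<tau> ((1 - discount M) / \<tau>) B \<epsilon> N1 N2 \<pi>0 \<pi> l n \<and>
    \<pi> = npg l \<pi>0 N2 \<and> n \<le> Suc J * N1 + N2 \<and> l \<in> {0..B} \<and>
    dual M \<tau> l - dual M \<tau> l_star \<le> B * (3 / 2 * \<epsilon>)"
proof -
  let ?h = "\<lambda>x. grad_sub M \<tau> ((1 - discount M) / \<tau>) x \<pi>0 N1"
  have B: "0 \<le> B" using l_star by auto
  have "\<exists>k l. (if dual_grad 0 \<ge> 0 then k = 0 \<and> l = 0
           else if dual_grad B \<le> 0 then k = 0 \<and> l = B
           else bisection_loop ?h \<epsilon> 0 B k l) \<and> k \<le> Suc J \<and> l \<in> {0..B} \<and>
         dual M \<tau> l - dual M \<tau> l_star \<le> B * (3 / 2 * \<epsilon>)"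
  proof -
    have gap0: "0 \<le> B * (3 / 2 * \<epsilon>)" using B \<epsilon> by simp
    consider "dual_grad 0 \<ge> 0" | "\<not> dual_grad 0 \<ge> 0" "dual_grad B \<le> 0" | "\<not> dual_grad 0 \<ge> 0" "\<not> dual_grad B \<le> 0"
      by blast
    then show ?thesis
    proof cases
      case 1
      have "0 \<le> (l_star - 0) * dual_grad 0" using 1 l_star by (intro mult_nonneg_nonneg) auto
      then show ?thesis
        using 1 B gap0 dual_subgradient[of 0 l_star] by (intro exI[of _ 0]) simp
    next
      case 2
      have "0 \<le> (l_star - B) * dual_grad B" using 2 l_star by (intro mult_nonpos_nonpos) auto
      then show ?thesis
        using 2 B gap0 dual_subgradient[of B l_star] by (intro exI[of _ 0] exI[of _ B]) simp
    next
      case 3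
      then obtain k l where kl: "bisection_loop ?h \<epsilon> 0 B k l" "k \<le> Suc J" "l \<in> {0..B}" "\<bar>?h l\<bar> < \<epsilon>"
        using bisection_loop_terminates[where a=0 and b=B and p=0 and q=B and n=J, OF dual_grad_lipschitz inexact \<epsilon>] B width by auto
      have "\<bar>dual_grad l\<bar> \<le> 3 / 2 * \<epsilon>"
        using inexact[OF kl(3)] kl(4) by linarith
      moreover have "\<bar>l - l_star\<bar> \<le> B" using kl l_star by auto
      ultimately have "\<bar>l - l_star\<bar> * \<bar>dual_grad l\<bar> \<le> B * (3 / 2 * \<epsilon>)"
        using B by (intro mult_mono) auto
      moreover have "- ((l_star - l) * dual_grad l) \<le> \<bar>l - l_star\<bar> * \<bar>dual_grad l\<bar>"
        unfolding abs_mult[symmetric] by (simp add: algebra_simps abs_le_iff)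
      ultimately have "dual M \<tau> l - dual M \<tau> l_star \<le> B * (3 / 2 * \<epsilon>)"
        using dual_subgradient[of l l_star] by linarith
      then show ?thesis using 3 kl by (intro exI[of _ k] exI[of _ l]) simp
    qed
  qed
  then obtain k l where kl: "if dual_grad 0 \<ge> 0 then k = 0 \<and> l = 0
           else if dual_grad B \<le> 0 then k = 0 \<and> l = B
           else bisection_loop ?h \<epsilon> 0 B k l" "k \<le> Suc J" "l \<in> {0..B}"
    "dual M \<tau> l - dual M \<tau> l_star \<le> B * (3 / 2 * \<epsilon>)"
    by blast
  have "bisection_npg M \<tau> ((1 - discount M) / \<tau>) B \<epsilon> N1 N2 \<pi>0 (npg l \<pi>0 N2) l (k * N1 + N2)"
    unfolding bisection_npg_def deriv_dual using kl(1) by (intro exI[of _ k] conjI refl)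
  moreover have "k * N1 + N2 \<le> Suc J * N1 + N2"
    using kl(2) by (intro add_right_mono mult_right_mono) auto
  ultimately show ?thesis using kl(3,4) by blast
qed

text \<open>Feasibility of \<open>\<pi>_star\<close> makes its Lagrangian at \<open>l\<close> at
  least the optimal value, hence within \<open>\<epsilon>0\<close> of the dual at \<open>l\<close>.
  Quadratic growth then places it near \<open>dual_policy l\<close>, which \<open>\<pi>\<close>
  approximates.\<close>

lemma primal_recovery:
  assumes \<pi>_star: "\<pi>_star \<in> softmax_policies" "threshold M \<le> U_val M \<pi>_star"
    and \<pi>: "\<pi> \<in> softmax_policies"
    and l: "l \<in> {0..B}" "V_reg M \<tau> \<pi>_star \<le> dual M \<tau> l" "dual M \<tau> l \<le> V_reg M \<tau> \<pi>_star + \<epsilon>0"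
    and close: "norm (policy_vec \<pi> - policy_vec (dual_policy l)) \<le> \<epsilon>1"
    and gap: "dual M \<tau> l - lagrangian M \<tau> \<pi> l \<le> U_lip * \<epsilon>1"
  defines "w \<equiv> 1 / sqrt growth_const * sqrt \<epsilon>0 + \<epsilon>1"
  shows "norm (policy_vec \<pi> - policy_vec \<pi>_star) \<le> w"
    and "\<bar>V_reg M \<tau> \<pi> - V_reg M \<tau> \<pi>_star\<bar> \<le> 2 * \<epsilon>0 + U_lip * \<epsilon>1 + B * (U_lip * w)"
    and "max (threshold M - U_val M \<pi>) 0 \<le> U_lip * w"
proof -
  let ?n = "norm (policy_vec \<pi>_star - policy_vec (dual_policy l))"
  have L_star: "lagrangian M \<tau> \<pi>_star l = V_reg M \<tau> \<pi>_star + l * (U_val M \<pi>_star - threshold M)"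
    by (simp add: lagrangian_def)
  have slack: "0 \<le> l * (U_val M \<pi>_star - threshold M)"
    using l \<pi>_star by simp
  have "growth_const * ?n\<^sup>2 \<le> \<epsilon>0"
    using dual_gap_ge_dist[OF \<pi>_star(1), of l] l slack L_star by linarith
  then have "sqrt (?n\<^sup>2) \<le> sqrt (\<epsilon>0 / growth_const)"
    using growth_const_pos by (intro real_sqrt_le_mono) (simp add: field_simps)
  then have "?n \<le> 1 / sqrt growth_const * sqrt \<epsilon>0"
    by (simp add: real_sqrt_divide)
  then show dist: "norm (policy_vec \<pi> - policy_vec \<pi>_star) \<le> w"
    using close norm_triangle_ineq4[of "policy_vec \<pi> - policy_vec (dual_policy l)" "policy_vec \<pi>_star - policy_vec (dual_policy l)"]
    by (simp add: w_def)
  have "U_lip * norm (policy_vec \<pi> - policy_vec \<pi>_star) \<le> U_lip * w"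
    using dist U_lip_pos by (intro mult_left_mono) auto
  then have U: "\<bar>U_val M \<pi> - U_val M \<pi>_star\<bar> \<le> U_lip * w"
    using U_val_lipschitz[of \<pi> \<pi>_star] by linarith
  then show "max (threshold M - U_val M \<pi>) 0 \<le> U_lip * w"
    using \<pi>_star by linarith
  have "\<bar>l * (U_val M \<pi> - U_val M \<pi>_star)\<bar> \<le> B * (U_lip * w)"
    unfolding abs_mult using l U by (intro mult_mono) auto
  \<comment> \<open>The error splits into the Lagrangian gap of \<open>\<pi>\<close>, the dual gap
    at \<open>l\<close>, the multiplier times the utility error, and the complementary slackness
    term of \<open>\<pi>_star\<close>.\<close>
  moreover have "V_reg M \<tau> \<pi> - V_reg M \<tau> \<pi>_star =
      (lagrangian M \<tau> \<pi> l - dual M \<tau> l) + (dual M \<tau> l - V_reg M \<tau> \<pi>_star)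
      - l * (U_val M \<pi> - U_val M \<pi>_star) - l * (U_val M \<pi>_star - threshold M)"
    by (simp add: lagrangian_def algebra_simps)
  moreover have "l * (U_val M \<pi>_star - threshold M) \<le> \<epsilon>0"
    using lagrangian_le_dual[OF \<pi>_star(1), of l] l unfolding L_star by linarith
  ultimately show "\<bar>V_reg M \<tau> \<pi> - V_reg M \<tau> \<pi>_star\<bar> \<le> 2 * \<epsilon>0 + U_lip * \<epsilon>1 + B * (U_lip * w)"
    using lagrangian_le_dual[OF \<pi>, of l] gap l slack by linarith
qed

end

lemma iteration_count_bigo:
  fixes J N1 N2 :: "real \<Rightarrow> nat"
  assumes "(\<lambda>x. real (Suc (J x))) \<in> O[at_right 0](\<lambda>x. ln (1 / x))"
    and "(\<lambda>x. real (Suc (N1 x))) \<in> O[at_right 0](\<lambda>x. ln (1 / x))"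
    and "(\<lambda>x. real (Suc (N2 x))) \<in> O[at_right 0](\<lambda>x. ln (1 / x))"
  shows "(\<lambda>(\<epsilon>0, \<epsilon>1). real (Suc (J \<epsilon>0) * Suc (N1 \<epsilon>0) + Suc (N2 \<epsilon>1)))
    \<in> O[at_right 0 \<times>\<^sub>F at_right 0](\<lambda>(\<epsilon>0, \<epsilon>1). (ln (1 / \<epsilon>0))\<^sup>2 + ln (1 / \<epsilon>1))"
proof -
  let ?F = "at_right (0 :: real) \<times>\<^sub>F at_right (0 :: real)"
  have "(\<lambda>x. real (Suc (J x)) * real (Suc (N1 x))) \<in> O[at_right 0](\<lambda>x. (ln (1 / x))\<^sup>2)"
    unfolding power2_eq_square by (intro landau_o.big.mult assms)
  then have "(\<lambda>z. real (Suc (J (fst z))) * real (Suc (N1 (fst z)))) \<in> O[?F](\<lambda>z. (ln (1 / fst z))\<^sup>2)"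
    by (rule landau_o.big.compose[OF _ filterlim_fst])
  moreover have "(\<lambda>z. real (Suc (N2 (snd z)))) \<in> O[?F](\<lambda>z. ln (1 / snd z))"
    by (rule landau_o.big.compose[OF assms(3) filterlim_snd])
  \<comment> \<open>With the second logarithm eventually nonnegative, as the square always is, each
    summand is dominated by the sum.\<close>
  moreover have "\<forall>\<^sub>F z in ?F. 0 \<le> ln (1 / snd z)"
  proof -
    have "\<forall>\<^sub>F x in at_right (0 :: real). 0 \<le> ln (1 / x)"
      using eventually_at_right_real[of 0 "1 :: real"] by (rule eventually_mono) (auto simp: ln_div)
    then show ?thesis
      by (rule eventually_compose_filterlim[OF _ filterlim_snd])
  qed
  then have "(\<lambda>z. (ln (1 / fst z))\<^sup>2) \<in> O[?F](\<lambda>z. (ln (1 / fst z))\<^sup>2 + ln (1 / snd z))"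
    and "(\<lambda>z. ln (1 / snd z)) \<in> O[?F](\<lambda>z. (ln (1 / fst z))\<^sup>2 + ln (1 / snd z))"
    by (auto intro!: bigoI[where c=1] elim!: eventually_mono)
  ultimately have "(\<lambda>z. real (Suc (J (fst z))) * real (Suc (N1 (fst z))) + real (Suc (N2 (snd z))))
      \<in> O[?F](\<lambda>z. (ln (1 / fst z))\<^sup>2 + ln (1 / snd z))"
    by (intro sum_in_bigo) (rule landau_o.big_trans; assumption)+
  then show ?thesis
    unfolding case_prod_beta of_nat_add of_nat_mult .
qed

section \<open>Choice of parameters and assembly of the bounds\<close>

theorem theorem6p1:
  fixes M :: "('s::finite, 'a::finite) cmdp"
    and \<tau> \<xi> d l_star :: real
    and \<pi>_bar \<pi>_star :: "('s, 'a) policy"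
  defines "\<gamma> \<equiv> discount M"
    and "b \<equiv> threshold M"
    and "V_star \<equiv> V_reg M \<tau> \<pi>_star"
    and "B \<equiv> (V_reg M \<tau> \<pi>_star - V_reg M \<tau> \<pi>_bar) / \<xi>"
    and "\<eta> \<equiv> (1 - discount M) / \<tau>"
    and "lc \<equiv> sqrt (real CARD('a)) / (1 - discount M)\<^sup>2"
  assumes cmdp: "wf_cmdp M"
    and tau: "\<tau> > 0"
    and slater: "\<pi>_bar \<in> softmax_policies" "\<xi> > 0" "U_val M \<pi>_bar - b \<ge> \<xi>"
    and strong_duality:
      "primal_optimal M \<tau> \<pi>_star"
      "is_arg_min (dual M \<tau>) (\<lambda>l. l \<ge> 0) l_star"
      "V_star = dual_opt M \<tau>"
      "dual_opt M \<tau> = lagrangian M \<tau> \<pi>_star l_star"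
    and exploration: "d > 0" "\<forall>\<pi>\<in>softmax_policies. \<forall>s. visitation M \<pi> (init M) s \<ge> d"
  shows "\<exists>C1>0. \<exists>C2>0. \<exists>(thr :: real \<Rightarrow> real \<Rightarrow> real) (N1 :: real \<Rightarrow> real \<Rightarrow> nat) (N2 :: real \<Rightarrow> real \<Rightarrow> nat)
           (T :: real \<Rightarrow> real \<Rightarrow> nat).
      (\<forall>\<epsilon>0>0. \<forall>\<epsilon>1>0. thr \<epsilon>0 \<epsilon>1 > 0 \<and>
        (\<forall>\<pi>0\<in>softmax_policies. \<exists>\<pi> l n.
           bisection_npg M \<tau> \<eta> B (thr \<epsilon>0 \<epsilon>1) (N1 \<epsilon>0 \<epsilon>1) (N2 \<epsilon>0 \<epsilon>1) \<pi>0 \<pi> l n \<and>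
           dual M \<tau> l - dual_opt M \<tau> \<le> \<epsilon>0 \<and>
           norm (policy_vec \<pi> - policy_vec \<pi>_star) \<le> C1 * sqrt \<epsilon>0 + \<epsilon>1 \<and>
           \<bar>V_reg M \<tau> \<pi> - V_star\<bar> \<le>
             2 * \<epsilon>0 + lc * C1 * C2 * sqrt \<epsilon>0 + (lc * C2 + 3 * \<gamma> / (2 * \<tau>)) * \<epsilon>1 \<and>
           max (b - U_val M \<pi>) 0 \<le> lc * (C1 * sqrt \<epsilon>0 + \<epsilon>1) \<and>
           n \<le> T \<epsilon>0 \<epsilon>1)) \<and>
      (\<lambda>(\<epsilon>0, \<epsilon>1). real (T \<epsilon>0 \<epsilon>1))
        \<in> O[at_right 0 \<times>\<^sub>F at_right 0](\<lambda>(\<epsilon>0, \<epsilon>1). (ln (1 / \<epsilon>0))\<^sup>2 + ln (1 / \<epsilon>1))"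
proof -
  interpret exploring_cmdp M \<tau> d
    using cmdp tau exploration by unfold_locales (auto simp: wf_cmdp_def)
  have l_star: "0 \<le> l_star"
    and l_star_min: "\<And>l. 0 \<le> l \<Longrightarrow> dual M \<tau> l_star \<le> dual M \<tau> l"
    using strong_duality(2) by (auto simp: is_arg_min_linorder)
  have dual_opt: "dual_opt M \<tau> = dual M \<tau> l_star"
    unfolding dual_opt_def by (rule cInf_eq_minimum) (use l_star l_star_min in auto)
  have \<pi>_star: "\<pi>_star \<in> softmax_policies" "threshold M \<le> U_val M \<pi>_star"
    using strong_duality(1) by (auto simp: primal_optimal_def is_arg_max_def)
  have V_star: "V_star = dual M \<tau> l_star"
    using strong_duality(3) dual_opt by simp
  \<comment> \<open>Slater's condition bounds the multiplier: the Lagrangian of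
    \<open>\<pi>_bar\<close> at \<open>l_star\<close> cannot exceed the dual optimum, so the initial
    bracket contains \<open>l_star\<close>.\<close>
  have l_star_B: "l_star \<in> {0..B}"
  proof -
    have "l_star * \<xi> \<le> l_star * (U_val M \<pi>_bar - b)"
      using l_star slater by (intro mult_left_mono) auto
    also have "\<dots> \<le> V_star - V_reg M \<tau> \<pi>_bar"
      using lagrangian_le_dual[OF slater(1), of l_star] by (simp add: V_star lagrangian_def b_def)
    finally show ?thesis
      using slater l_star by (simp add: B_def V_star_def field_simps)
  qed
  then have B: "B \<ge> 0" by auto
  have lc: "lc = U_lip" by (simp add: lc_def U_lip_def)
  define C1 where "C1 = 1 / sqrt growth_const"
  define K where "K = value_bound (1 + B)"
  define C where "C = real (CARD('s) * CARD('a)) * max 1 (2 * K / \<tau>)"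
  \<comment> \<open>The discount may be 0, whereas \<open>log_many_steps\<close> takes logarithms of
    a positive base.\<close>
  define \<beta> where "\<beta> = max (1 / 2) (discount M)"
  \<comment> \<open>With threshold \<open>\<epsilon>0 / D\<close> the dual gap is at most
    \<open>3 / 2 * B * \<epsilon>0 / D\<close>, and \<open>D\<close> exceeds
    \<open>3 / 2 * B\<close> while staying positive for \<open>B = 0\<close>.\<close>
  define D where "D = 2 * B + 1"
  have D: "D > 0" using B by (simp add: D_def)
  have \<beta>: "0 < \<beta>" "\<beta> < 1" "discount M ^ n \<le> \<beta> ^ n" for n
    by (auto simp: \<beta>_def intro!: power_mono)
  \<comment> \<open>The factor \<open>2 * D\<close> converts the accuracy \<open>\<epsilon>0\<close>
    into half the threshold, as required of the bracket width here and of the gradient error for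
    \<open>N1\<close>.\<close>
  obtain J where J: "\<And>x. x > 0 \<Longrightarrow> grad_lip * B * (2 * D) * (1 / 2) ^ J x \<le> x"
    and J_O: "(\<lambda>x. real (Suc (J x))) \<in> O[at_right 0](\<lambda>x. ln (1 / x))"
    using log_many_steps[of "1 / 2" "grad_lip * B * (2 * D)"] by auto
  obtain N1 where N1: "\<And>x. x > 0 \<Longrightarrow> U_lip * C * (2 * D) * \<beta> ^ N1 x \<le> x"
    and N1_O: "(\<lambda>x. real (Suc (N1 x))) \<in> O[at_right 0](\<lambda>x. ln (1 / x))"
    using log_many_steps[OF \<beta>(1,2), of "U_lip * C * (2 * D)"] by auto
  \<comment> \<open>The sum of constants makes one length serve two purposes: a policy error of at
    most \<open>\<epsilon>1\<close> and a Lagrangian gap of at most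
    \<open>U_lip * \<epsilon>1\<close>.\<close>
  obtain N2 where N2: "\<And>x. x > 0 \<Longrightarrow> (C + K / U_lip) * \<beta> ^ N2 x \<le> x"
    and N2_O: "(\<lambda>x. real (Suc (N2 x))) \<in> O[at_right 0](\<lambda>x. ln (1 / x))"
    using log_many_steps[OF \<beta>(1,2), of "C + K / U_lip"] by auto
  have K: "K \<ge> 0"
    using B tau by (simp add: K_def value_bound_def Suc_leI)
  have C: "C \<ge> 0" by (simp add: C_def)
  define T where "T \<epsilon>0 \<epsilon>1 = Suc (J \<epsilon>0) * Suc (N1 \<epsilon>0) + Suc (N2 \<epsilon>1)" for \<epsilon>0 \<epsilon>1
  have main: "\<exists>\<pi> l n. bisection_npg M \<tau> \<eta> B (\<epsilon>0 / D) (N1 \<epsilon>0) (N2 \<epsilon>1) \<pi>0 \<pi> l n \<and>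
           dual M \<tau> l - dual_opt M \<tau> \<le> \<epsilon>0 \<and>
           norm (policy_vec \<pi> - policy_vec \<pi>_star) \<le> C1 * sqrt \<epsilon>0 + \<epsilon>1 \<and>
           \<bar>V_reg M \<tau> \<pi> - V_star\<bar> \<le>
             2 * \<epsilon>0 + lc * C1 * (B + 1) * sqrt \<epsilon>0 + (lc * (B + 1) + 3 * \<gamma> / (2 * \<tau>)) * \<epsilon>1 \<and>
           max (b - U_val M \<pi>) 0 \<le> lc * (C1 * sqrt \<epsilon>0 + \<epsilon>1) \<and> n \<le> T \<epsilon>0 \<epsilon>1"
    if \<epsilon>: "\<epsilon>0 > 0" "\<epsilon>1 > 0" and \<pi>0: "\<pi>0 \<in> softmax_policies" for \<epsilon>0 \<epsilon>1 \<pi>0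
  proof -
    have inexact: "\<bar>grad_sub M \<tau> ((1 - discount M) / \<tau>) l \<pi>0 (N1 \<epsilon>0) - dual_grad l\<bar> \<le> \<epsilon>0 / D / 2"
      if l: "l \<in> {0..B}" for l
    proof -
      have "\<bar>grad_sub M \<tau> ((1 - discount M) / \<tau>) l \<pi>0 (N1 \<epsilon>0) - dual_grad l\<bar>
          \<le> U_lip * norm (policy_vec (npg l \<pi>0 (N1 \<epsilon>0)) - policy_vec (dual_policy l))"
        using U_val_lipschitz[of "npg l \<pi>0 (N1 \<epsilon>0)" "dual_policy l"]
        by (simp add: grad_sub_def dual_grad_def)
      also have "\<dots> \<le> U_lip * (C * discount M ^ N1 \<epsilon>0)"
        using npg_dual_policy_gap[OF \<pi>0 l] U_lip_pos by (intro mult_left_mono) (simp_all add: C_def K_def)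
      also have "\<dots> \<le> U_lip * (C * \<beta> ^ N1 \<epsilon>0)"
        using U_lip_pos C \<beta> by (intro mult_left_mono) auto
      also have "\<dots> \<le> \<epsilon>0 / D / 2"
        using N1[OF \<epsilon>(1)] D by (simp add: field_simps)
      finally show ?thesis .
    qed
    have pos: "\<epsilon>0 / D > 0" using \<epsilon> D by simp
    have width: "grad_lip * B \<le> 2 ^ J \<epsilon>0 * (\<epsilon>0 / D / 2)"
      using J[OF \<epsilon>(1)] D by (simp add: field_simps)
    obtain \<pi> l n where bis: "bisection_npg M \<tau> ((1 - discount M) / \<tau>) B (\<epsilon>0 / D) (N1 \<epsilon>0) (N2 \<epsilon>1) \<pi>0 \<pi> l n"
      and \<pi>: "\<pi> = npg l \<pi>0 (N2 \<epsilon>1)" and n: "n \<le> Suc (J \<epsilon>0) * N1 \<epsilon>0 + N2 \<epsilon>1" and l: "l \<in> {0..B}"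
      and gap: "dual M \<tau> l - dual M \<tau> l_star \<le> B * (3 / 2 * (\<epsilon>0 / D))"
      using bisection_dual_gap[OF pos l_star_B inexact width, of "N2 \<epsilon>1"] by blast
    have "B * (3 / 2 * (\<epsilon>0 / D)) \<le> \<epsilon>0"
      using D B \<epsilon> mult_nonneg_nonneg[of B \<epsilon>0] by (simp add: field_simps D_def)
    then have gap0: "dual M \<tau> l - dual M \<tau> l_star \<le> \<epsilon>0" using gap by linarith
    have \<pi>_softmax: "\<pi> \<in> softmax_policies" unfolding \<pi> by (rule npg_softmax[OF \<pi>0])
    have "C * discount M ^ N2 \<epsilon>1 + K / U_lip * discount M ^ N2 \<epsilon>1 \<le> (C + K / U_lip) * \<beta> ^ N2 \<epsilon>1"
      unfolding distrib_right[symmetric] using K C U_lip_pos \<beta> by (intro mult_left_mono) auto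
    then have sum: "C * discount M ^ N2 \<epsilon>1 + K / U_lip * discount M ^ N2 \<epsilon>1 \<le> \<epsilon>1"
      using N2[OF \<epsilon>(2)] by linarith
    moreover have nn: "0 \<le> C * discount M ^ N2 \<epsilon>1" "0 \<le> K / U_lip * discount M ^ N2 \<epsilon>1"
      using K C U_lip_pos by auto
    ultimately have close: "norm (policy_vec \<pi> - policy_vec (dual_policy l)) \<le> \<epsilon>1"
      using npg_dual_policy_gap[OF \<pi>0 l, of "N2 \<epsilon>1"] unfolding \<pi> C_def K_def by linarith
    have "K / U_lip * discount M ^ N2 \<epsilon>1 \<le> \<epsilon>1" using sum nn by linarith
    then have "discount M ^ N2 \<epsilon>1 * K \<le> U_lip * \<epsilon>1"
      using U_lip_pos by (simp add: field_simps)
    then have lgap: "dual M \<tau> l - lagrangian M \<tau> \<pi> l \<le> U_lip * \<epsilon>1"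
      using npg_lagrangian_gap[OF \<pi>0 l, of "N2 \<epsilon>1"] unfolding \<pi> K_def by linarith
    note rec = primal_recovery[OF \<pi>_star \<pi>_softmax l _ _ close lgap, of \<epsilon>0, folded C1_def V_star_def lc b_def]
    have V1: "V_star \<le> dual M \<tau> l" and V2: "dual M \<tau> l \<le> V_star + \<epsilon>0"
      using l_star_min[of l] l gap0 by (auto simp: V_star)
    \<comment> \<open>This fixes the second constant as \<open>B + 1\<close>: \<open>B\<close> from
      the multiplier times the utility error, and 1 from the Lagrangian gap. What remains on the
      right is nonnegative slack.\<close>
    have "2 * \<epsilon>0 + lc * \<epsilon>1 + B * (lc * (C1 * sqrt \<epsilon>0 + \<epsilon>1)) \<le>
        2 * \<epsilon>0 + lc * C1 * (B + 1) * sqrt \<epsilon>0 + (lc * (B + 1) + 3 * \<gamma> / (2 * \<tau>)) * \<epsilon>1"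
    proof -
      have "0 \<le> lc * C1 * sqrt \<epsilon>0" "0 \<le> 3 * \<gamma> / (2 * \<tau>) * \<epsilon>1"
        using U_lip_pos growth_const_pos \<epsilon> tau by (auto simp: lc C1_def \<gamma>_def less_imp_le)
      then show ?thesis by (simp add: algebra_simps)
    qed
    then have "\<bar>V_reg M \<tau> \<pi> - V_star\<bar> \<le>
        2 * \<epsilon>0 + lc * C1 * (B + 1) * sqrt \<epsilon>0 + (lc * (B + 1) + 3 * \<gamma> / (2 * \<tau>)) * \<epsilon>1"
      using rec(2)[OF V1 V2] by linarith
    moreover have "n \<le> T \<epsilon>0 \<epsilon>1"
      using n by (simp add: T_def)
    ultimately show ?thesis
      unfolding \<eta>_def dual_opt using bis gap0 rec(1,3)[OF V1 V2]
      by (intro exI[of _ \<pi>] exI[of _ l] exI[of _ n] conjI)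
  qed
  have pos: "C1 > 0" "B + 1 > 0" "\<And>x. x > 0 \<Longrightarrow> x / D > 0"
    using growth_const_pos B D by (simp_all add: C1_def)
  have count: "(\<lambda>(\<epsilon>0, \<epsilon>1). real (T \<epsilon>0 \<epsilon>1))
      \<in> O[at_right 0 \<times>\<^sub>F at_right 0](\<lambda>(\<epsilon>0, \<epsilon>1). (ln (1 / \<epsilon>0))\<^sup>2 + ln (1 / \<epsilon>1))"
    unfolding T_def by (rule iteration_count_bigo[OF J_O N1_O N2_O])
  show ?thesis
    by (rule exI[of _ C1], rule conjI[OF pos(1)], rule exI[of _ "B + 1"], rule conjI[OF pos(2)],
        rule exI[of _ "\<lambda>\<epsilon>0 \<epsilon>1. \<epsilon>0 / D"], rule exI[of _ "\<lambda>\<epsilon>0 \<epsilon>1. N1 \<epsilon>0"], rule exI[of _ "\<lambda>\<epsilon>0. N2"],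
        rule exI[of _ T], rule conjI[OF _ count], intro allI impI conjI ballI pos main)
qed

end
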